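(* Let $n$ be a positive integer and let $\omega$ be the involution on $Q_n$ induced by the ring involution of $R_n=\mathbb{Z}[x_1,\ldots,x_n,q_{ij}\mid 1\le i<j\le n]$ given by $\omega(x_i)=-x_{n+1-i}$ and $\omega(q_{ij})=(-1)^{j-i+1}q_{n+1-j\,n+1-i}$. For any $1\le i\le j\le n$, $$\omega(E_i^{(j)})=H_i^{(n-j)}$$ in the quotient ring $Q_n=R_n/(E_1^{(n)},\ldots,E_n^{(n)})$.
   Context: For $0\le j\le n$ let $M_j$ be the $j\times j$ matrix with diagonal entries $x_1,\ldots,x_j$, with $(a,b)$ entry $q_{ab}$ for $a<b$, with entries $-1$ in positions $(a+1,a)$, and $0$ elsewhere. Define $E_i^{(j)}\in R_n$ by $\det(tI_j-M_j)=\sum_{i=0}^{j}(-1)^iE_i^{(j)}t^{j-i}$, with $E_0^{(j)}=1$ and $E_i^{(j)}=0$ unless $0\le i\le j$. The involution $\omega$ of $R_n$ satisfies $\omega(E_i^{(n)})=(-1)^iE_i^{(n)}$, hence induces an involution on $Q_n$, also denoted $\omega$. An element of $R_n$ and its image in $Q_n$ are denoted by the same symbol. $\mathbf{q}$-quantization: let $e_i^{(j)}=e_i(x_1,\ldots,x_j)$ be the elementary symmetric polynomial ($e_0^{(j)}=1$, $e_i^{(j)}=0$ unless $0\le i\le j$). The standard elementary monomials $e_{i_1,\ldots,i_m}=e_{i_1}^{(1)}\cdots e_{i_m}^{(m)}$ ($0\le i_k\le k$; sequences differing by trailing zeros are identified) form a $\mathbb{Z}$-basis of $\mathbb{Z}[x_1,x_2,\ldots]$.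 If $f=\sum c_{i_1,\ldots,i_m}e_{i_1,\ldots,i_m}$, its $\mathbf{q}$-quantization is $F=\sum c_{i_1,\ldots,i_m}E_{i_1}^{(1)}\cdots E_{i_m}^{(m)}$ (it lies in $R_n$ when only indices $m\le n$ occur, which is the case here). $H_i^{(j)}$ is the $\mathbf{q}$-quantization of the complete symmetric polynomial $h_i^{(j)}=h_i(x_1,\ldots,x_j)$, with $h_0^{(j)}=1$ and $h_i^{(0)}=0$ for $i>0$. *)

theory Defs
  imports
    "HOL-Library.Poly_Mapping"
    "HOL-Library.Multiset"
    "HOL-Algebra.QuotRing"
    "Jordan_Normal_Form.Char_Poly"
begin

text \<open>
  All polynomials live in one ambient polynomial ring over the integers in the
  variables \<open>x\<^sub>k\<close> (\<open>X k\<close>) and \<open>q\<^sub>i\<^sub>j\<close> (\<open>Q i j\<close>); the ring \<open>R n\<close> is the subring of those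
  polynomials in which only \<open>x\<^sub>1, ..., x\<^sub>n\<close> and \<open>q\<^sub>i\<^sub>j\<close> with \<open>1 \<le> i < j \<le> n\<close> occur.
\<close>

datatype qvar = X nat | Q nat nat

type_synonym qpoly = "(qvar \<Rightarrow>\<^sub>0 nat) \<Rightarrow>\<^sub>0 int"

definition var :: "qvar \<Rightarrow> qpoly" where
  "var v = Poly_Mapping.single (Poly_Mapping.single v 1) 1"

definition vars_R :: "nat \<Rightarrow> qvar set" where
  "vars_R n = {X i | i. 1 \<le> i \<and> i \<le> n} \<union> {Q i j | i j. 1 \<le> i \<and> i < j \<and> j \<le> n}"

definition R :: "nat \<Rightarrow> qpoly ring" where
  "R n = \<lparr>carrier = {p. \<forall>m \<in> Poly_Mapping.keys p. Poly_Mapping.keys m \<subseteq> vars_R n},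
          monoid.mult = (*), one = 1, zero = 0, add = (+)\<rparr>"

definition subst :: "(qvar \<Rightarrow> qpoly) \<Rightarrow> qpoly \<Rightarrow> qpoly" where
  "subst \<sigma> p = (\<Sum>m \<in> Poly_Mapping.keys p. of_int (Poly_Mapping.lookup p m) *
     (\<Prod>v \<in> Poly_Mapping.keys m. \<sigma> v ^ Poly_Mapping.lookup m v))"


section \<open>The polynomials \<open>E\<close>\<close>

text \<open>Matrices are indexed from 0, so row and column \<open>a\<close> here is number \<open>a + 1\<close> in \<open>M\<^sub>j\<close>.\<close>

definition M :: "nat \<Rightarrow> qpoly mat" where
  "M j = mat j j (\<lambda>(a, b).
     if a = b then var (X (a + 1))
     else if a < b then var (Q (a + 1) (b + 1))
     else if a = b + 1 then - 1
     else 0)"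

text \<open>\<open>char_poly (M j)\<close> is \<open>det (t I\<^sub>j - M\<^sub>j)\<close> as a polynomial in \<open>t\<close>.\<close>

definition E :: "nat \<Rightarrow> nat \<Rightarrow> qpoly" where
  "E i j = (if i \<le> j then (- 1) ^ i * coeff (char_poly (M j)) (j - i) else 0)"


section \<open>Quantization\<close>

definition elem_sym :: "nat \<Rightarrow> nat \<Rightarrow> qpoly" where
  "elem_sym i j = (\<Sum>A | A \<subseteq> {1..j} \<and> card A = i. \<Prod>k \<in> A. var (X k))"

definition complete_sym :: "nat \<Rightarrow> nat \<Rightarrow> qpoly" where
  "complete_sym i j = (\<Sum>A | set_mset A \<subseteq> {1..j} \<and> size A = i. \<Prod>k \<in># A. var (X k))"

text \<open>
  Sequences \<open>i\<^sub>1, ..., i\<^sub>m\<close> up to trailing zeros are finitely supported functions; the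
  bound at \<open>k = 0\<close> makes the unused position 0 vanish.
\<close>

definition std_index :: "(nat \<Rightarrow>\<^sub>0 nat) set" where
  "std_index = {I. \<forall>k. Poly_Mapping.lookup I k \<le> k}"

definition std_elem_monomial :: "(nat \<Rightarrow>\<^sub>0 nat) \<Rightarrow> qpoly" where
  "std_elem_monomial I = (\<Prod>k \<in> Poly_Mapping.keys I. elem_sym (Poly_Mapping.lookup I k) k)"

definition quantum_std_elem_monomial :: "(nat \<Rightarrow>\<^sub>0 nat) \<Rightarrow> qpoly" where
  "quantum_std_elem_monomial I = (\<Prod>k \<in> Poly_Mapping.keys I. E (Poly_Mapping.lookup I k) k)"

text \<open>
  The following two are meaningful for polynomials in the \<open>x\<^sub>k\<close> only, for which the
  coefficients exist and are unique because the standard elementary monomials form a basis.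
\<close>

definition std_coeffs :: "qpoly \<Rightarrow> (nat \<Rightarrow>\<^sub>0 nat) \<Rightarrow>\<^sub>0 int" where
  "std_coeffs f = (THE c. Poly_Mapping.keys c \<subseteq> std_index \<and>
     f = (\<Sum>I \<in> Poly_Mapping.keys c. of_int (Poly_Mapping.lookup c I) * std_elem_monomial I))"

definition quantization :: "qpoly \<Rightarrow> qpoly" where
  "quantization f =
     (\<Sum>I \<in> Poly_Mapping.keys (std_coeffs f). of_int (Poly_Mapping.lookup (std_coeffs f) I) *
       quantum_std_elem_monomial I)"

definition H :: "nat \<Rightarrow> nat \<Rightarrow> qpoly" where
  "H i j = quantization (complete_sym i j)"


section \<open>The quotient ring and its involution\<close>

definition E_ideal :: "nat \<Rightarrow> qpoly set" where
  "E_ideal n = Idl\<^bsub>R n\<^esub> {E i n | i. 1 \<le> i \<and> i \<le> n}"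

definition Q_ring :: "nat \<Rightarrow> qpoly set ring" where
  "Q_ring n = R n Quot E_ideal n"

definition to_Q :: "nat \<Rightarrow> qpoly \<Rightarrow> qpoly set" where
  "to_Q n f = E_ideal n +>\<^bsub>R n\<^esub> f"

text \<open>The natural-number subtractions are exact for the variables in \<open>vars_R n\<close>.\<close>

fun omega_var :: "nat \<Rightarrow> qvar \<Rightarrow> qpoly" where
  "omega_var n (X i) = - var (X (n + 1 - i))"
| "omega_var n (Q i j) = (- 1) ^ (j - i + 1) * var (Q (n + 1 - j) (n + 1 - i))"

definition omega :: "nat \<Rightarrow> qpoly \<Rightarrow> qpoly" where
  "omega n = subst (omega_var n)"

text \<open>
  The map induced by \<open>omega n\<close> on cosets: \<open>the_elem\<close> picks the common class of the images
  of all representatives.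
\<close>

definition omega_Q :: "nat \<Rightarrow> qpoly set \<Rightarrow> qpoly set" where
  "omega_Q n = (\<lambda>C \<in> carrier (Q_ring n).
     the_elem ((\<lambda>f. to_Q n (omega n f)) ` C))"

end

(* Let P(k,l) be the characteristic polynomial of the diagonal block of M_n in rows k+1, ..., l.
   It is a weighted path sum, so it can be expanded along the first row or along the last column.
   Reversing paths shows that omega(E_i^(j)) is a coefficient of P(n-j,n).  By induction on n the
   polynomial P(0,l) P(k,n) - P(0,n) P(k,l) has degree at most n - 2 for k <= l <= n; since P(0,n) is
   congruent to t^n modulo the ideal, the coefficient of t^(n-1) in P(0,l) P(k,n) vanishes in Q_n.
   With l = k + m - 1 this reads sum_i (-1)^i E_i^(l) omega(E_{m-i}^(n-k)) = 0.  The same recurrence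
   sum_i (-1)^i e_i^(l) h_{m-i}^(k) = 0 holds classically, and as h_{m-i}^(k), i > 0, only involves
   e^(s) with s < l, it survives quantization.  Hence both sides agree by induction on m.

   Quantization is well defined because the standard elementary monomials are independent: if
   sum_i f_i e_i^(N) = 0, where the f_i are combinations of monomials in e^(1), ..., e^(N-1), evaluate
   at the permutations of N distinct numbers y; then sum_i e_i(y) f_i has degree at most N - s in x_s
   and vanishes at all these permutations, hence identically, and varying y gives f_i = 0. *)

theory Submission
  imports Defs "HOL-Computational_Algebra.Formal_Power_Series"
begin

section \<open>Linear extension and evaluation\<close>

text \<open>Three linear maps are instances: evaluation of polynomials, and the expansions in
  standard elementary monomials and in their quantum counterparts.\<close>

definition lin :: "('k \<Rightarrow> 'a::comm_ring_1) \<Rightarrow> ('k \<Rightarrow>\<^sub>0 int) \<Rightarrow> 'a" where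
  "lin g c = (\<Sum>k \<in> Poly_Mapping.keys c. of_int (Poly_Mapping.lookup c k) * g k)"

lemma lin_superset:
  assumes "finite S" "Poly_Mapping.keys c \<subseteq> S"
  shows "lin g c = (\<Sum>k \<in> S. of_int (Poly_Mapping.lookup c k) * g k)"
  unfolding lin_def using assms by (intro sum.mono_neutral_left) (auto simp: in_keys_iff)

lemma lin_0 [simp]: "lin g 0 = 0"
  by (simp add: lin_def)

lemma lin_single [simp]: "lin g (Poly_Mapping.single k v) = of_int v * g k"
  by (simp add: lin_def)

lemma lin_1 [simp]: "lin g 1 = g 0"
  by (simp add: lin_def)

lemma lin_add: "lin g (c + d) = lin g c + lin g d"
proof -
  let ?S = "Poly_Mapping.keys c \<union> Poly_Mapping.keys d"
  have "lin g (c + d) = (\<Sum>k \<in> ?S. of_int (Poly_Mapping.lookup (c + d) k) * g k)"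
    by (intro lin_superset) (auto dest: subsetD[OF keys_add])
  moreover have "lin g c = (\<Sum>k \<in> ?S. of_int (Poly_Mapping.lookup c k) * g k)"
    "lin g d = (\<Sum>k \<in> ?S. of_int (Poly_Mapping.lookup d k) * g k)"
    by (auto intro: lin_superset)
  ultimately show ?thesis
    by (simp add: lookup_add sum.distrib algebra_simps)
qed

lemma lin_uminus: "lin g (- c) = - lin g c"
  using lin_add[of g c "- c"] by (simp add: eq_neg_iff_add_eq_0 add.commute)

lemma lin_diff: "lin g (c - d) = lin g c - lin g d"
  using lin_add[of g c "- d"] by (simp add: lin_uminus)

lemma lin_sum: "lin g (sum f A) = (\<Sum>a\<in>A. lin g (f a))"
  by (induction A rule: infinite_finite_induct) (auto simp: lin_add)

lemma poly_mapping_eq_sum_single: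
  "c = (\<Sum>k \<in> Poly_Mapping.keys c. Poly_Mapping.single k (Poly_Mapping.lookup c k))"
  by (rule poly_mapping_eqI) (auto simp: lookup_sum lookup_single when_def in_keys_iff)

lemma lin_mult:
  fixes c d :: "'k::monoid_add \<Rightarrow>\<^sub>0 int"
  assumes "\<And>k l. g (k + l) = g k * g l"
  shows "lin g (c * d) = lin g c * lin g d"
proof -
  let ?s = "\<lambda>c k. Poly_Mapping.single k (Poly_Mapping.lookup c k)"
  have "c * d = (\<Sum>k \<in> Poly_Mapping.keys c. \<Sum>l \<in> Poly_Mapping.keys d. ?s c k * ?s d l)"
    by (simp flip: sum_product poly_mapping_eq_sum_single)
  then have "lin g (c * d) = (\<Sum>k \<in> Poly_Mapping.keys c. \<Sum>l \<in> Poly_Mapping.keys d.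
      (of_int (Poly_Mapping.lookup c k) * g k) * (of_int (Poly_Mapping.lookup d l) * g l))"
    by (simp add: lin_sum mult_single assms algebra_simps)
  then show ?thesis
    by (simp add: lin_def sum_product)
qed

definition monom_eval :: "('v \<Rightarrow> 'a::comm_ring_1) \<Rightarrow> ('v \<Rightarrow>\<^sub>0 nat) \<Rightarrow> 'a" where
  "monom_eval \<sigma> m = (\<Prod>v \<in> Poly_Mapping.keys m. \<sigma> v ^ Poly_Mapping.lookup m v)"

lemma monom_eval_superset:
  assumes "finite S" "Poly_Mapping.keys m \<subseteq> S"
  shows "monom_eval \<sigma> m = (\<Prod>v \<in> S. \<sigma> v ^ Poly_Mapping.lookup m v)"
  unfolding monom_eval_def using assms by (intro prod.mono_neutral_left) (auto simp: in_keys_iff)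

lemma monom_eval_add: "monom_eval \<sigma> (m + m') = monom_eval \<sigma> m * monom_eval \<sigma> m'"
proof -
  let ?S = "Poly_Mapping.keys m \<union> Poly_Mapping.keys m'"
  have "monom_eval \<sigma> (m + m') = (\<Prod>v \<in> ?S. \<sigma> v ^ Poly_Mapping.lookup (m + m') v)"
    by (intro monom_eval_superset) (auto dest: subsetD[OF keys_add])
  moreover have "monom_eval \<sigma> m = (\<Prod>v \<in> ?S. \<sigma> v ^ Poly_Mapping.lookup m v)"
    "monom_eval \<sigma> m' = (\<Prod>v \<in> ?S. \<sigma> v ^ Poly_Mapping.lookup m' v)"
    by (auto intro: monom_eval_superset)
  ultimately show ?thesis
    by (simp add: lookup_add power_add prod.distrib)
qed

text \<open>The target ring is arbitrary because \<omega> takes values in \<open>qpoly\<close>,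
  while the independence argument evaluates at integer points.\<close>

definition peval :: "(qvar \<Rightarrow> 'a::comm_ring_1) \<Rightarrow> qpoly \<Rightarrow> 'a" where
  "peval \<sigma> = lin (monom_eval \<sigma>)"

lemma subst_eq_peval: "subst = peval"
  by (intro ext) (simp add: subst_def peval_def lin_def monom_eval_def)

lemma peval_hom: "comm_ring_hom (peval \<sigma>)"
proof
  show "peval \<sigma> 1 = 1"
    by (simp add: peval_def monom_eval_def flip: single_one)
qed (simp_all add: peval_def lin_add lin_mult monom_eval_add)

lemma peval_var [simp]: "peval \<sigma> (var v) = \<sigma> v"
  by (simp add: peval_def var_def monom_eval_def)

lemma omega_hom: "comm_ring_hom (omega n)"
  by (simp add: omega_def subst_eq_peval peval_hom)

lemma omega_var [simp]: "omega n (var v) = omega_var n v"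
  by (simp add: omega_def subst_eq_peval)

section \<open>Weighted paths and Hessenberg determinants\<close>

text \<open>The sum over all strictly increasing sequences from \<open>k\<close> to \<open>l\<close>
  of the products of the weights of consecutive pairs; it is 0 for \<open>k > l\<close>.\<close>

function path :: "(nat \<Rightarrow> nat \<Rightarrow> 'a::comm_ring_1) \<Rightarrow> nat \<Rightarrow> nat \<Rightarrow> 'a" where
  "path c k l = (if k < l then \<Sum>a \<in> {k<..l}. c k a * path c a l else if k = l then 1 else 0)"
  by auto
termination by (relation "measure (\<lambda>(c, k, l). l - k)") auto

declare path.simps [simp del]

lemma path_refl [simp]: "path c k k = 1"
  by (subst path.simps) simp

lemma path_first: "k < l \<Longrightarrow> path c k l = (\<Sum>a \<in> {k<..l}. c k a * path c a l)"
  by (subst path.simps) simp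

text \<open>The same sum over increasing sequences, grouped by the last step instead of the first.
  Apart from the single step from \<open>k\<close> to \<open>l\<close>, each sequence has a first
  stop a and a last stop b with a \<le> b, and the double sum over both can be taken in either
  order.\<close>

lemma path_last:
  assumes "k < l"
  shows "path c k l = (\<Sum>b \<in> {k..<l}. path c k b * c b l)"
  using assms
proof (induction "l - k" arbitrary: k rule: less_induct)
  case less
  have IH: "path c a l = (\<Sum>b \<in> {a..<l}. path c a b * c b l)" if "a \<in> {k<..<l}" for a
    using less.hyps[of a] that by auto
  have "path c k l = c k l * path c l l + (\<Sum>a \<in> {k<..<l}. c k a * path c a l)"
  proof -
    have "{k<..l} = insert l {k<..<l}" using less.prems by auto
    then show ?thesis using less.prems by (simp add: path_first)
  qed
  also have "(\<Sum>a \<in> {k<..<l}. c k a * path c a l)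
      = (\<Sum>a \<in> {k<..<l}. \<Sum>b \<in> {a..<l}. c k a * path c a b * c b l)"
    by (intro sum.cong refl) (simp add: IH sum_distrib_left mult.assoc)
  also have "\<dots> = (\<Sum>b \<in> {k<..<l}. \<Sum>a \<in> {k<..b}. c k a * path c a b * c b l)"
    by (subst sum.Sigma, simp, simp, subst sum.Sigma, simp, simp, intro sum.reindex_bij_witness[of _ "\<lambda>(b, a). (a, b)" "\<lambda>(a, b). (b, a)"]) auto
  also have "\<dots> = (\<Sum>b \<in> {k<..<l}. path c k b * c b l)"
    by (intro sum.cong refl) (simp add: path_first sum_distrib_right)
  also have "c k l * path c l l + \<dots> = (\<Sum>b \<in> {k..<l}. path c k b * c b l)"
  proof -
    have "{k..<l} = insert k {k<..<l}" using less.prems by auto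
    then show ?thesis by simp
  qed
  finally show ?case .
qed

text \<open>The reflection a -> n - a reverses increasing sequences, so an expansion by first steps
  becomes one by last steps. The step lengths add up to \<open>l - k\<close>, hence so do the
  exponents of the signs.\<close>

lemma path_hom_reverse:
  assumes "comm_ring_hom \<phi>"
    and "\<And>a b. a < b \<Longrightarrow> b \<le> n \<Longrightarrow> \<phi> (c a b) = (- 1) ^ (b - a) * d (n - b) (n - a)"
    and "k \<le> l" "l \<le> n"
  shows "\<phi> (path c k l) = (- 1) ^ (l - k) * path d (n - l) (n - k)"
  using assms(3)
proof (induction "l - k" arbitrary: k rule: less_induct)
  case less
  interpret \<phi>: comm_ring_hom \<phi> by fact
  show ?case
  proof (cases "k = l")
    case True
    then show ?thesis by simp
  next
    case False
    with less.prems have kl: "k < l" by simp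
    have "\<phi> (path c k l) = (\<Sum>a \<in> {k<..l}. \<phi> (c k a) * \<phi> (path c a l))"
      by (simp add: path_first[OF kl] \<phi>.hom_sum \<phi>.hom_mult)
    also have "\<dots> = (\<Sum>a \<in> {k<..l}. (- 1) ^ (l - k) * (path d (n - l) (n - a) * d (n - a) (n - k)))"
    proof (rule sum.cong[OF refl])
      fix a assume a: "a \<in> {k<..l}"
      then have "(- 1 :: 'b) ^ (l - k) = (- 1) ^ (a - k) * (- 1) ^ (l - a)"
        by (simp flip: power_add)
      moreover have "\<phi> (path c a l) = (- 1) ^ (l - a) * path d (n - l) (n - a)"
        using less.hyps[of a] a by auto
      moreover have "\<phi> (c k a) = (- 1) ^ (a - k) * d (n - a) (n - k)"
        using assms(2)[of k a] assms(4) a by auto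
      ultimately show "\<phi> (c k a) * \<phi> (path c a l)
          = (- 1) ^ (l - k) * (path d (n - l) (n - a) * d (n - a) (n - k))"
        by (simp add: algebra_simps)
    qed
    also have "\<dots> = (- 1) ^ (l - k) * (\<Sum>b \<in> {n - l..<n - k}. path d (n - l) b * d b (n - k))"
      unfolding sum_distrib_left using assms(4)
      by (intro sum.reindex_bij_witness[of _ "\<lambda>b. n - b" "\<lambda>a. n - a"]) auto
    also have "\<dots> = (- 1) ^ (l - k) * path d (n - l) (n - k)"
      using kl assms(4) by (subst path_last[symmetric]) auto
    finally show ?thesis .
  qed
qed

section \<open>Hessenberg determinants as path sums\<close>

text \<open>The first row is kept arbitrary so that the matrices are closed under the minors of the
  first column.\<close>

definition hessenberg :: "(nat \<Rightarrow> nat \<Rightarrow> 'a::comm_ring_1) \<Rightarrow> nat \<Rightarrow> nat \<Rightarrow> (nat \<Rightarrow> 'a) \<Rightarrow> 'a mat" where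
  "hessenberg w k n r = mat n n (\<lambda>(i, j). if i = 0 then r j else if i \<le> j then w (k + i) (k + j)
     else if i = j + 1 then 1 else 0)"

lemma hessenberg_carrier [simp]: "hessenberg w k n r \<in> carrier_mat n n"
  by (simp add: hessenberg_def)

text \<open>In the first column only the top entry and the 1 below it are nonzero. Deleting the top
  row leaves the next block with its own first row; deleting the second row leaves the rest of
  \<open>r\<close> on top of that block. For \<open>n = 0\<close> there is no second row.\<close>

lemma det_hessenberg_Suc:
  "det (hessenberg w k (Suc n) r) = r 0 * det (hessenberg w (Suc k) n (\<lambda>j. w (Suc k) (Suc k + j)))
     - (if n = 0 then 0 else det (hessenberg w (Suc k) n (\<lambda>j. r (Suc j))))"
proof -
  let ?A = "hessenberg w k (Suc n) r"
  have del0: "mat_delete ?A 0 0 = hessenberg w (Suc k) n (\<lambda>j. w (Suc k) (Suc k + j))"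
    by (rule eq_matI) (auto simp: mat_delete_def hessenberg_def)
  have "det ?A = (\<Sum>i<Suc n. ?A $$ (i, 0) * cofactor ?A i 0)"
    by (rule laplace_expansion_column[OF hessenberg_carrier]) simp
  also have "\<dots> = r 0 * cofactor ?A 0 0 + (\<Sum>i<n. ?A $$ (Suc i, 0) * cofactor ?A (Suc i) 0)"
    by (subst sum.lessThan_Suc_shift) (simp add: hessenberg_def)
  also have "(\<Sum>i<n. ?A $$ (Suc i, 0) * cofactor ?A (Suc i) 0)
      = (\<Sum>i<n. if i = 0 then cofactor ?A 1 0 else 0)"
    by (intro sum.cong refl) (auto simp: hessenberg_def)
  also have "\<dots> = (if n = 0 then 0 else cofactor ?A 1 0)"
    by simp
  also have "\<dots> = - (if n = 0 then 0 else det (hessenberg w (Suc k) n (\<lambda>j. r (Suc j))))"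
  proof (cases "n = 0")
    case False
    then have "mat_delete ?A 1 0 = hessenberg w (Suc k) n (\<lambda>j. r (Suc j))"
      by (intro eq_matI) (auto simp: mat_delete_def hessenberg_def)
    with False show ?thesis by (simp add: cofactor_def)
  qed simp
  finally show ?thesis by (simp add: cofactor_def del0)
qed

lemma det_hessenberg:
  assumes "n > 0"
  shows "det (hessenberg w k n r)
    = (\<Sum>j<n. (- 1) ^ j * r j * det (hessenberg w (k + Suc j) (n - Suc j) (\<lambda>i. w (k + Suc j) (k + Suc j + i))))"
  using assms
proof (induction n arbitrary: k r)
  case (Suc n)
  show ?case
  proof (cases "n = 0")
    case True
    then show ?thesis by (simp add: det_hessenberg_Suc)
  next
    case False
    then show ?thesis
      by (subst sum.lessThan_Suc_shift) (simp add: det_hessenberg_Suc[of w k] Suc.IH sum_negf)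
  qed
qed simp

text \<open>A step from a to b stands for the entry in row a and column b - 1; the sign is the one
  this entry collects in \<open>det_hessenberg\<close>, and the remaining block starts at row
  b.\<close>

lemma det_hessenberg_path:
  "det (hessenberg w k n (\<lambda>j. w k (k + j))) = path (\<lambda>a b. (- 1) ^ (b - a - 1) * w a (b - 1)) k (k + n)"
proof (induction n arbitrary: k rule: less_induct)
  case (less n)
  show ?case
  proof (cases "n = 0")
    case True
    then show ?thesis by simp
  next
    case False
    let ?c = "\<lambda>a b. (- 1) ^ (b - a - 1) * w a (b - 1)"
    have "det (hessenberg w k n (\<lambda>j. w k (k + j)))
        = (\<Sum>j<n. (- 1) ^ j * w k (k + j) * path ?c (k + Suc j) (k + n))"
    proof (subst det_hessenberg, use False in simp, intro sum.cong refl arg_cong2[where f = "(*)"])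
      fix j assume "j \<in> {..<n}"
      then show "det (hessenberg w (k + Suc j) (n - Suc j) (\<lambda>i. w (k + Suc j) (k + Suc j + i)))
          = path ?c (k + Suc j) (k + n)"
        by (subst less.IH) auto
    qed
    also have "\<dots> = (\<Sum>a \<in> {k<..k + n}. ?c k a * path ?c a (k + n))"
      by (intro sum.reindex_bij_witness[of _ "\<lambda>a. a - k - 1" "\<lambda>j. k + Suc j"]) auto
    also have "\<dots> = path ?c k (k + n)"
      using False by (subst (2) path_first) auto
    finally show ?thesis .
  qed
qed

text \<open>With these weights \<open>path wt k l\<close> is the polynomial P(k,l). A step of length
  one passes a diagonal entry t - x_b; a longer one passes an entry -q, whose minus sign joins the
  (-1)^(b - a - 1) of \<open>det_hessenberg_path\<close>.\<close>

definition wt :: "nat \<Rightarrow> nat \<Rightarrow> qpoly poly" where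
  "wt a b = (if b = Suc a then [:- var (X b), 1:] else [:(- 1) ^ (b - a) * var (Q (Suc a) b):])"

lemma path_cong:
  assumes "\<And>a b. k \<le> a \<Longrightarrow> a < b \<Longrightarrow> b \<le> l \<Longrightarrow> c a b = d a b"
  shows "path c k l = path d k l"
  using assms
proof (induction "l - k" arbitrary: k rule: less_induct)
  case less
  show ?case
  proof (cases "k < l")
    case True
    then show ?thesis
      unfolding path_first[OF True] using less.hyps less.prems
      by (intro sum.cong refl arg_cong2[where f = "(*)"]) auto
  next
    case False
    then show ?thesis by (simp add: path.simps)
  qed
qed

lemma minus_one_power_pCons: "(- 1) ^ m * [:x:] = [:(- 1) ^ m * x :: 'a::comm_ring_1:]"
  by (induction m) auto

lemma char_poly_M: "char_poly (M j) = path wt 0 j"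
proof -
  let ?w = "\<lambda>a b. if a = b then [:- var (X (Suc a)), 1:] else [:- var (Q (Suc a) (Suc b)):] :: qpoly poly"
  have "char_poly_matrix (M j) = hessenberg ?w 0 j (\<lambda>i. ?w 0 (0 + i))"
    by (rule eq_matI) (auto simp: char_poly_matrix_def M_def hessenberg_def one_pCons)
  then have "char_poly (M j) = path (\<lambda>a b. (- 1) ^ (b - a - 1) * ?w a (b - 1)) 0 (0 + j)"
    unfolding char_poly_def by (rule trans[OF arg_cong[of _ _ det] det_hessenberg_path])
  also have "\<dots> = path wt 0 j"
    unfolding add_0
  proof (rule path_cong)
    fix a b :: nat assume ab: "a < b"
    then obtain d where d: "b = Suc (a + d)" using less_iff_Suc_add by auto
    show "(- 1) ^ (b - a - 1) * ?w a (b - 1) = wt a b"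
    proof (cases d)
      case 0
      then show ?thesis by (simp add: d wt_def)
    next
      case (Suc d')
      have "(- 1) ^ (b - a - 1) * ?w a (b - 1) = (- 1) ^ d * [:- var (Q (Suc a) b):]"
        by (simp add: d Suc)
      also have "\<dots> = [:(- 1) ^ d * - var (Q (Suc a) b):]"
        by (rule minus_one_power_pCons)
      also have "\<dots> = wt a b"
        by (simp add: d Suc wt_def)
      finally show ?thesis .
    qed
  qed
  finally show ?thesis .
qed

lemma E_eq: "i \<le> j \<Longrightarrow> E i j = (- 1) ^ i * coeff (path wt 0 j) (j - i)"
  by (simp add: E_def char_poly_M)

text \<open>Three signs cancel: (-1)^i from the definition of \<open>E\<close>, (-1)^(j - i) from
  the substitution t -> -t, and (-1)^j from reversing paths.\<close>

lemma omega_E: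
  assumes "i \<le> j" "j \<le> n"
  shows "omega n (E i j) = coeff (path wt (n - j) n) (j - i)"
proof -
  interpret \<omega>: comm_ring_hom "omega n" by (rule omega_hom)
  interpret \<omega>p: map_poly_comm_ring_hom "omega n" ..
  \<comment> \<open>\<omega> maps x to some -x', which turns t - x into t + x'; replacing t by -t as
    well gives -(t - x'), so every weight is reversed with the uniform sign (-1)^(b - a).\<close>
  define \<Phi> where "\<Phi> p = map_poly (omega n) p \<circ>\<^sub>p [:0, - 1:]" for p
  have hom: "comm_ring_hom \<Phi>"
    by standard (auto simp: \<Phi>_def \<omega>p.hom_add \<omega>p.hom_mult pcompose_add pcompose_mult)
  have coeff_\<Phi>: "coeff (\<Phi> p) m = (- 1) ^ m * omega n (coeff p m)" for p m
    by (simp add: \<Phi>_def coeff_pcompose_linear)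
  have \<Phi>_wt: "\<Phi> (wt a b) = (- 1) ^ (b - a) * wt (n - b) (n - a)" if "a < b" "b \<le> n" for a b
  proof -
    have \<Phi>_const: "\<Phi> [:x:] = [:omega n x:]" for x
      by (rule poly_eqI) (simp add: coeff_\<Phi> coeff_pCons split: nat.split)
    show ?thesis
    proof (cases "b = Suc a")
      case True
      then show ?thesis using that
        by (simp add: \<Phi>_def wt_def pcompose_pCons Suc_diff_Suc \<omega>.hom_uminus \<omega>p.hom_uminus)
    next
      case False
      have "\<Phi> (wt a b) = [:(- 1) ^ (b - a) * ((- 1) ^ (b - a) * var (Q (Suc (n - b)) (n - a))):]"
        using False that
        by (simp add: wt_def \<Phi>_const \<omega>.hom_mult \<omega>.hom_power \<omega>.hom_uminus Suc_diff_le Suc_diff_Suc)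
      also have "\<dots> = (- 1) ^ (b - a) * wt (n - b) (n - a)"
      proof -
        have "wt (n - b) (n - a) = [:(- 1) ^ (b - a) * var (Q (Suc (n - b)) (n - a)):]"
          using False that by (auto simp: wt_def)
        then show ?thesis by (simp only: minus_one_power_pCons)
      qed
      finally show ?thesis .
    qed
  qed
  have "\<Phi> (path wt 0 j) = (- 1) ^ (j - 0) * path wt (n - j) (n - 0)"
    by (rule path_hom_reverse[OF hom]) (use \<Phi>_wt assms in auto)
  then have "\<Phi> (path wt 0 j) = (- 1) ^ j * path wt (n - j) n" by simp
  moreover have "coeff ((- 1) ^ m * p) s = (- 1) ^ m * coeff p s" for m s and p :: "qpoly poly"
    by (induction m) auto
  ultimately have "(- 1) ^ (j - i) * omega n (coeff (path wt 0 j) (j - i))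
      = (- 1) ^ j * coeff (path wt (n - j) n) (j - i)"
    by (metis coeff_\<Phi>)
  moreover have "(- 1 :: qpoly) ^ j = (- 1) ^ (j - i) * (- 1) ^ i"
    using assms by (simp flip: power_add)
  ultimately have "(- 1) ^ (j - i) * omega n (coeff (path wt 0 j) (j - i))
      = (- 1) ^ (j - i) * ((- 1) ^ i * coeff (path wt (n - j) n) (j - i))"
    by (simp add: mult.assoc)
  then have "(- 1) ^ (j - i) * ((- 1) ^ (j - i) * omega n (coeff (path wt 0 j) (j - i)))
      = (- 1) ^ (j - i) * ((- 1) ^ (j - i) * ((- 1) ^ i * coeff (path wt (n - j) n) (j - i)))"
    by simp
  then show ?thesis
    using assms
    by (simp add: E_eq \<omega>.hom_mult \<omega>.hom_power \<omega>.hom_uminus flip: mult.assoc power_add mult_2)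
qed

section \<open>Degrees and leading coefficients\<close>

lemma degree_wt: "a < b \<Longrightarrow> degree (wt a b) \<le> (if b = Suc a then 1 else 0)"
  by (simp add: wt_def)

lemma degree_path_wt: "k \<le> l \<Longrightarrow> degree (path wt k l) \<le> l - k"
proof (induction "l - k" arbitrary: k rule: less_induct)
  case less
  show ?case
  proof (cases "k = l")
    case False
    with less.prems have kl: "k < l" by simp
    show ?thesis
      unfolding path_first[OF kl]
    proof (rule degree_sum_le)
      fix a assume a: "a \<in> {k<..l}"
      have "degree (wt k a * path wt a l) \<le> degree (wt k a) + degree (path wt a l)"
        by (rule degree_mult_le)
      also have "\<dots> \<le> (a - k) + (l - a)"
        using degree_wt[of k a] less.hyps[of a] a by (intro add_mono) (auto split: if_splits)
      also have "\<dots> = l - k"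
        using a by auto
      finally show "degree (wt k a * path wt a l) \<le> l - k" .
    qed simp
  qed simp
qed

lemma coeff_linear_mult:
  "coeff ([:- x, 1:] * p) s = (case s of 0 \<Rightarrow> 0 | Suc t \<Rightarrow> coeff p t) - x * coeff p s"
  for x :: "'a::comm_ring_1"
  by (cases s) simp_all

lemma coeff_path_wt_top: "k \<le> l \<Longrightarrow> coeff (path wt k l) (l - k) = 1"
proof (induction "l - k" arbitrary: k rule: less_induct)
  case less
  show ?case
  proof (cases "k = l")
    case False
    with less.prems have kl: "k < l" by simp
    \<comment> \<open>A first step of length at least two has constant weight and loses degree, so
      only the step to \<open>Suc k\<close> reaches the top coefficient.\<close>
    have zero: "coeff (wt k a * path wt a l) (l - k) = 0" if "a \<in> {Suc k<..l}" for a
    proof (rule coeff_eq_0)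
      have "degree (wt k a * path wt a l) \<le> degree (wt k a) + degree (path wt a l)"
        by (rule degree_mult_le)
      also have "\<dots> \<le> 0 + (l - a)"
        using degree_wt[of k a] degree_path_wt[of a l] that by (intro add_mono) auto
      also have "\<dots> < l - k"
        using that by auto
      finally show "degree (wt k a * path wt a l) < l - k" .
    qed
    have "{k<..l} = insert (Suc k) {Suc k<..l}"
      using kl by auto
    then have "coeff (path wt k l) (l - k) = coeff (wt k (Suc k) * path wt (Suc k) l) (l - k)"
      unfolding path_first[OF kl] by (simp add: coeff_sum zero)
    also have "\<dots> = coeff (path wt (Suc k) l) (l - Suc k) - var (X (Suc k)) * coeff (path wt (Suc k) l) (l - k)"
      using kl by (simp add: wt_def Suc_diff_Suc[symmetric] coeff_linear_mult del: mult_pCons_left)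
    also have "\<dots> = 1"
      using less.hyps[of "Suc k"] degree_path_wt[of "Suc k" l] kl by (simp add: coeff_eq_0)
    finally show ?thesis .
  qed simp
qed

text \<open>Expand P(0,n) and P(k,n) by their last step, from b to n. For b \<ge> k the terms
  combine to the same expression with b in place of n, to which induction applies; for b < k only
  P(0,n) contributes, with terms of low degree.\<close>

lemma path_wt_cross_coeff:
  assumes "k \<le> l" "l \<le> n" "n \<le> Suc s"
  shows "coeff (path wt 0 l * path wt k n - path wt 0 n * path wt k l) s = 0"
  using assms
proof (induction n arbitrary: l s rule: less_induct)
  case (less n)
  define D where "D l n = path wt 0 l * path wt k n - path wt 0 n * path wt k l" for l n
  show ?case
  proof (cases "l = n")
    case False
    with less.prems have ln: "l < n" by simp
    \<comment> \<open>Exchanging the arguments of \<open>D\<close> only changes the sign, so the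
      induction hypothesis also covers b < l.\<close>
    have IH: "coeff (D l b) t = 0" if "k \<le> b" "b < n" "l \<le> Suc t" "b \<le> Suc t" for b t
    proof (cases "l \<le> b")
      case True
      then show ?thesis using less.IH[of b l t] less.prems that by (simp add: D_def)
    next
      case False
      then have "coeff (D b l) t = 0"
        using less.IH[of l b t] ln that by (simp add: D_def)
      moreover have "D l b = - D b l"
        by (simp add: D_def)
      ultimately show ?thesis by (simp del: minus_diff_eq)
    qed
    have "path wt 0 n = (\<Sum>b \<in> {0..<k}. path wt 0 b * wt b n) + (\<Sum>b \<in> {k..<n}. path wt 0 b * wt b n)"
      using less.prems ln by (subst path_last) (simp_all add: sum.atLeastLessThan_concat)
    moreover have "path wt k n = (\<Sum>b \<in> {k..<n}. path wt k b * wt b n)"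
      using less.prems ln by (subst path_last) simp_all
    ultimately have "D l n = (\<Sum>b \<in> {k..<n}. D l b * wt b n)
        - (\<Sum>b \<in> {0..<k}. path wt 0 b * wt b n * path wt k l)"
      unfolding D_def
      by (simp add: algebra_simps sum_distrib_left sum_distrib_right sum_subtractf)
    moreover have "coeff (D l b * wt b n) s = 0" if b: "b \<in> {k..<n}" for b
    proof (cases "n = Suc b")
      case True
      \<comment> \<open>The linear weight t - x_n calls for the coefficients of \<open>D l b\<close>
        at s and s - 1; both vanish because l and b are at most n - 1.\<close>
      have "coeff (D l b) s = 0"
        using IH[of b s] b True less.prems ln by auto
      moreover have "(case s of 0 \<Rightarrow> 0 | Suc t \<Rightarrow> coeff (D l b) t) = 0"
        using IH[of b "s - 1"] b True less.prems ln by (auto split: nat.split)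
      moreover have "D l b * wt b n = [:- var (X n), 1:] * D l b"
        unfolding wt_def if_P[OF True] by (rule mult.commute)
      ultimately show ?thesis
        by (simp only: coeff_linear_mult) simp
    next
      case False
      then show ?thesis using IH[of b s] b less.prems ln
        by (simp add: wt_def)
    qed
    \<comment> \<open>As b < k < n, the step from b to n has length at least two and constant
      weight. The degree is thus at most b + (l - k) < l, hence at most n - 2.\<close>
    moreover have "coeff (path wt 0 b * wt b n * path wt k l) s = 0" if b: "b \<in> {0..<k}" for b
    proof (rule coeff_eq_0)
      have "degree (path wt 0 b * wt b n * path wt k l)
          \<le> degree (path wt 0 b) + degree (wt b n) + degree (path wt k l)"
        by (meson add_right_mono degree_mult_le order.trans)
      also have "\<dots> \<le> b + 0 + (l - k)"
        using degree_path_wt[of 0 b] degree_wt[of b n] degree_path_wt[of k l] b less.prems ln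
        by (intro add_mono) (auto split: if_splits)
      also have "\<dots> < s"
        using b less.prems ln by auto
      finally show "degree (path wt 0 b * wt b n * path wt k l) < s" .
    qed
    ultimately have "coeff (D l n) s = 0"
      by (simp add: coeff_sum)
    then show ?thesis by (simp add: D_def)
  qed simp
qed

section \<open>The ring and the ideal\<close>

lemma carrier_R: "carrier (R n) = {p. \<forall>m \<in> Poly_Mapping.keys p. Poly_Mapping.keys m \<subseteq> vars_R n}"
  by (simp add: R_def)

lemma R_simps [simp]:
  "x \<oplus>\<^bsub>R n\<^esub> y = x + y" "x \<otimes>\<^bsub>R n\<^esub> y = x * y" "\<zero>\<^bsub>R n\<^esub> = 0" "\<one>\<^bsub>R n\<^esub> = 1"
  by (simp_all add: R_def)

lemma R_add: "p \<in> carrier (R n) \<Longrightarrow> q \<in> carrier (R n) \<Longrightarrow> p + q \<in> carrier (R n)"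
  unfolding carrier_R using keys_add[of p q] by blast

lemma R_uminus: "p \<in> carrier (R n) \<Longrightarrow> - p \<in> carrier (R n)"
  unfolding carrier_R by simp

lemma R_mult:
  assumes "p \<in> carrier (R n)" "q \<in> carrier (R n)"
  shows "p * q \<in> carrier (R n)"
  unfolding carrier_R
proof safe
  fix m v assume "m \<in> Poly_Mapping.keys (p * q)" and v: "v \<in> Poly_Mapping.keys m"
  then obtain a b where "m = a + b" "a \<in> Poly_Mapping.keys p" "b \<in> Poly_Mapping.keys q"
    using keys_mult[of p q] by blast
  then show "v \<in> vars_R n"
    using assms v keys_add[of a b] unfolding carrier_R by blast
qed

lemma R_0 [simp]: "0 \<in> carrier (R n)" and R_1 [simp]: "1 \<in> carrier (R n)"
  by (simp_all add: carrier_R)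

lemma R_power: "p \<in> carrier (R n) \<Longrightarrow> p ^ i \<in> carrier (R n)"
  by (induction i) (auto intro: R_mult)

lemma R_minus_one_power [simp]: "(- 1) ^ i \<in> carrier (R n)"
  by (intro R_power R_uminus R_1)

lemma R_sum: "(\<And>a. a \<in> A \<Longrightarrow> f a \<in> carrier (R n)) \<Longrightarrow> sum f A \<in> carrier (R n)"
  by (induction A rule: infinite_finite_induct) (auto intro: R_add)

lemma R_var: "v \<in> vars_R n \<Longrightarrow> var v \<in> carrier (R n)"
  by (simp add: carrier_R var_def)

lemma cring_R: "cring (R n)"
proof (rule cringI)
  show "abelian_group (R n)"
  proof (rule abelian_groupI)
    fix x assume "x \<in> carrier (R n)"
    then show "\<exists>y \<in> carrier (R n). y \<oplus>\<^bsub>R n\<^esub> x = \<zero>\<^bsub>R n\<^esub>"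
      by (intro bexI[of _ "- x"]) (auto intro: R_uminus)
  qed (auto intro: R_add simp: algebra_simps)
  show "comm_monoid (R n)"
    by (rule comm_monoidI) (auto intro: R_mult simp: algebra_simps)
qed (auto simp: algebra_simps)

lemma coeff_wt_in_R:
  assumes "a < b" "b \<le> n"
  shows "coeff (wt a b) s \<in> carrier (R n)"
proof -
  have "X b \<in> vars_R n" "b \<noteq> Suc a \<Longrightarrow> Q (Suc a) b \<in> vars_R n"
    using assms by (auto simp: vars_R_def)
  then show ?thesis
    by (auto simp: wt_def coeff_pCons split: nat.split intro!: R_var R_mult R_uminus)
qed

lemma coeff_mult_in_R:
  "(\<And>s. coeff p s \<in> carrier (R n)) \<Longrightarrow> (\<And>s. coeff q s \<in> carrier (R n)) \<Longrightarrow> coeff (p * q) s \<in> carrier (R n)"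
  unfolding coeff_mult by (intro R_sum R_mult)

lemma coeff_path_in_R: "l \<le> n \<Longrightarrow> coeff (path wt k l) s \<in> carrier (R n)"
proof (induction "l - k" arbitrary: k s rule: less_induct)
  case less
  show ?case
  proof (cases "k < l")
    case True
    show ?thesis
      unfolding path_first[OF True] coeff_sum using less
      by (intro R_sum coeff_mult_in_R coeff_wt_in_R) auto
  next
    case False
    then show ?thesis by (simp add: path.simps[of wt k l])
  qed
qed

lemma E_in_R: "j \<le> n \<Longrightarrow> E i j \<in> carrier (R n)"
  unfolding E_def char_poly_M by (auto intro: R_mult coeff_path_in_R)

section \<open>The ideal and the recurrence modulo it\<close>

lemma E_ideal_ideal: "ideal (E_ideal n) (R n)"
  unfolding E_ideal_def using cring_R by (intro ring.genideal_ideal cring.axioms(1)) (auto intro: E_in_R)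

lemma E_in_E_ideal:
  assumes "1 \<le> i" "i \<le> n"
  shows "E i n \<in> E_ideal n"
proof -
  have "{E i n | i. 1 \<le> i \<and> i \<le> n} \<subseteq> E_ideal n"
    unfolding E_ideal_def using cring_R by (intro ring.genideal_self cring.axioms(1)) (auto intro: E_in_R)
  then show ?thesis using assms by blast
qed

lemma E_ideal_0: "0 \<in> E_ideal n"
  using additive_subgroup.zero_closed[OF ideal.axioms(1)[OF E_ideal_ideal], of n] by simp

lemma E_ideal_add: "p \<in> E_ideal n \<Longrightarrow> q \<in> E_ideal n \<Longrightarrow> p + q \<in> E_ideal n"
  using additive_subgroup.a_closed[OF ideal.axioms(1)[OF E_ideal_ideal]] by simp

lemma E_ideal_mult: "r \<in> carrier (R n) \<Longrightarrow> p \<in> E_ideal n \<Longrightarrow> r * p \<in> E_ideal n"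
  using ideal.I_l_closed[OF E_ideal_ideal] by simp

lemma E_ideal_uminus: "p \<in> E_ideal n \<Longrightarrow> - p \<in> E_ideal n"
  using E_ideal_mult[of "- 1" n p] R_uminus[OF R_1, of n] by simp

lemma E_ideal_diff: "p \<in> E_ideal n \<Longrightarrow> q \<in> E_ideal n \<Longrightarrow> p - q \<in> E_ideal n"
  using E_ideal_add[of p n "- q"] by (simp add: E_ideal_uminus)

lemma E_ideal_sum: "(\<And>a. a \<in> A \<Longrightarrow> f a \<in> E_ideal n) \<Longrightarrow> sum f A \<in> E_ideal n"
  by (induction A rule: infinite_finite_induct) (auto intro: E_ideal_add E_ideal_0)

text \<open>Below the leading term, the coefficients of P(0,n) are up to sign the generators of the
  ideal.\<close>

lemma coeff_path_in_E_ideal: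
  assumes "s < n"
  shows "coeff (path wt 0 n) s \<in> E_ideal n"
proof -
  have "E (n - s) n = (- 1) ^ (n - s) * coeff (path wt 0 n) s"
    using assms by (subst E_eq) auto
  then have "coeff (path wt 0 n) s = (- 1) ^ (n - s) * E (n - s) n"
    by (simp flip: mult.assoc power_add mult_2)
  then show ?thesis
    using E_in_E_ideal[of "n - s" n] assms by (simp add: E_ideal_mult)
qed

lemma alternating_sum_in_E_ideal:
  assumes "k \<le> n" "1 \<le> m" "m \<le> n - k"
  shows "(\<Sum>i\<le>m. (- 1) ^ i * E i (k + m - 1) * coeff (path wt k n) (n - k - (m - i))) \<in> E_ideal n"
proof -
  define l where "l = k + m - 1"
  have l: "k \<le> l" "l < n" "Suc l = k + m"
    using assms by (auto simp: l_def)
  \<comment> \<open>At index n - 1 the two products agree by \<open>path_wt_cross_coeff\<close>; the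
    second involves only coefficients of P(0,n) below its leading term, all in the ideal.\<close>
  have "coeff (path wt 0 l * path wt k n) (n - 1) = coeff (path wt 0 n * path wt k l) (n - 1)"
    using path_wt_cross_coeff[of k l n "n - 1"] l by simp
  also have "\<dots> \<in> E_ideal n"
    unfolding coeff_mult using l
    by (intro E_ideal_sum) (auto simp: mult.commute[of "coeff (path wt 0 n) _"]
        intro!: E_ideal_mult coeff_path_in_R coeff_path_in_E_ideal)
  also have "coeff (path wt 0 l * path wt k n) (n - 1)
      = (\<Sum>s\<le>n - 1. coeff (path wt 0 l) s * coeff (path wt k n) (n - 1 - s))"
    by (rule coeff_mult)
  \<comment> \<open>The degree bounds leave s \<le> l and n - 1 - s \<le> n - k; since l + 1 = k +
    m, the latter means l \<le> m + s.\<close>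
  also have "\<dots> = (\<Sum>s \<in> {s. s \<le> l \<and> l \<le> m + s}. coeff (path wt 0 l) s * coeff (path wt k n) (n - 1 - s))"
  proof (rule sum.mono_neutral_right, simp, use l in force, intro ballI)
    fix s assume s: "s \<in> {..n - 1} - {s. s \<le> l \<and> l \<le> m + s}"
    show "coeff (path wt 0 l) s * coeff (path wt k n) (n - 1 - s) = 0"
    proof (cases "s \<le> l")
      case False
      then show ?thesis using degree_path_wt[of 0 l] by (simp add: coeff_eq_0)
    next
      case True
      then have "n - k < n - 1 - s" using s l by auto
      then show ?thesis using degree_path_wt[of k n] assms by (simp add: coeff_eq_0)
    qed
  qed
  \<comment> \<open>Reindexing by i = l - s. The bound i \<le> l is dropped in the end because
    \<open>E i l\<close> is 0 for i > l.\<close>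
  also have "\<dots> = (\<Sum>i \<in> {..m} \<inter> {..l}. coeff (path wt 0 l) (l - i) * coeff (path wt k n) (n - k - (m - i)))"
    using l assms
    by (intro sum.reindex_bij_witness[of _ "\<lambda>i. l - i" "\<lambda>s. l - s"])
      (auto intro!: arg_cong2[where f = "(*)"] arg_cong[where f = "coeff (path wt k n)"])
  also have "\<dots> = (\<Sum>i \<in> {..m} \<inter> {..l}. (- 1) ^ i * E i l * coeff (path wt k n) (n - k - (m - i)))"
    by (intro sum.cong refl) (simp add: E_eq flip: mult.assoc power_add mult_2)
  also have "\<dots> = (\<Sum>i\<le>m. (- 1) ^ i * E i l * coeff (path wt k n) (n - k - (m - i)))"
    by (intro sum.mono_neutral_left) (auto simp: E_def)
  finally show ?thesis by (simp add: l_def)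
qed

section \<open>Independence of the standard elementary monomials\<close>

text \<open>The generating polynomial, a product of factors 1 + x_s t, makes the recursion in
  \<open>k\<close> and the symmetry immediate. The ring is arbitrary to allow integer points as well
  as the variables themselves.\<close>

definition esym :: "(nat \<Rightarrow> 'a::comm_ring_1) \<Rightarrow> nat \<Rightarrow> nat \<Rightarrow> 'a" where
  "esym x i k = coeff (\<Prod>s \<in> {1..k}. [:1, x s:]) i"

lemma esym_eq_sum_subsets: "esym x i k = (\<Sum>A | A \<subseteq> {1..k} \<and> card A = i. \<Prod>s \<in> A. x s)"
proof -
  have mono: "(\<Prod>s \<in> A. [:0, x s:]) = monom (\<Prod>s \<in> A. x s) (card A)" for A
  proof (induction A rule: infinite_finite_induct)
    case (insert s A)
    have "[:0, x s:] = monom (x s) 1" by (simp add: monom_Suc monom_0)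
    with insert show ?case by (simp add: mult_monom)
  qed (simp_all add: monom_0 one_pCons)
  have "(\<Prod>s \<in> {1..k}. [:1, x s:]) = (\<Prod>s \<in> {1..k}. [:0, x s:] + 1)"
    by (intro prod.cong refl) (simp add: one_pCons)
  also have "\<dots> = (\<Sum>A \<in> Pow {1..k}. monom (\<Prod>s \<in> A. x s) (card A))"
    by (subst prod_add) (simp_all add: mono)
  finally have "esym x i k = (\<Sum>A \<in> Pow {1..k}. if card A = i then \<Prod>s \<in> A. x s else 0)"
    by (simp add: esym_def coeff_sum)
  also have "\<dots> = (\<Sum>A \<in> {A \<in> Pow {1..k}. card A = i}. \<Prod>s \<in> A. x s)"
    by (subst sum.inter_filter) auto
  finally show ?thesis by simp
qed

lemma esym_0 [simp]: "esym x 0 k = 1"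
  unfolding esym_def poly_0_coeff_0[symmetric] by (simp add: poly_prod)

lemma esym_0_right [simp]: "esym x i 0 = (if i = 0 then 1 else 0)"
  by (simp add: esym_def)

lemma esym_Suc: "esym x i (Suc k) = esym x i k + x (Suc k) * (case i of 0 \<Rightarrow> 0 | Suc j \<Rightarrow> esym x j k)"
proof -
  have "(\<Prod>s \<in> {1..Suc k}. [:1, x s:]) = [:1, x (Suc k):] * (\<Prod>s \<in> {1..k}. [:1, x s:])"
    by (simp add: mult.commute)
  then show ?thesis
    unfolding esym_def by (simp add: coeff_pCons split: nat.split)
qed

lemma esym_eq_0: "k < i \<Longrightarrow> esym x i k = 0"
  by (induction k arbitrary: i) (auto simp: esym_Suc split: nat.split)

lemma esym_cong: "(\<And>s. 1 \<le> s \<Longrightarrow> s \<le> k \<Longrightarrow> x s = y s) \<Longrightarrow> esym x i k = esym y i k"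
  unfolding esym_def by (intro arg_cong[where f = "\<lambda>p. coeff p i"] prod.cong) auto

lemma esym_permute:
  assumes "inj_on x {1..k}" "inj_on y {1..k}" "x ` {1..k} = y ` {1..k}"
  shows "esym x i k = esym y i k"
proof -
  have "(\<Prod>s \<in> {1..k}. [:1, x s:]) = (\<Prod>z \<in> x ` {1..k}. [:1, z:])"
    using assms(1) by (simp add: prod.reindex)
  also have "\<dots> = (\<Prod>s \<in> {1..k}. [:1, y s:])"
    unfolding assms(3) using assms(2) by (simp add: prod.reindex)
  finally show ?thesis by (simp add: esym_def)
qed

lemma inj_on_atLeastAtMost_Suc:
  "inj_on f {1..k} \<Longrightarrow> f (Suc k) \<notin> f ` {1..k} \<Longrightarrow> inj_on f {1..Suc k}"
  using inj_on_insert[of f "Suc k" "{1..k}"] by (simp add: atLeastAtMostSuc_conv)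

text \<open>Adjoining a last coordinate z turns the relation into g + z h = 0, where g and h are
  relations in one variable less. Infinitely many integers z avoid the values of y, and two of them
  already force g = h = 0.\<close>

lemma esym_independent:
  fixes c :: "nat \<Rightarrow> int"
  assumes "\<And>y. inj_on y {1..k} \<Longrightarrow> (\<Sum>i\<le>k. c i * esym y i k) = 0"
    and "i \<le> k"
  shows "c i = 0"
  using assms
proof (induction k arbitrary: c i)
  case 0
  show ?case using "0.prems"(1)[of "\<lambda>_. 0"] "0.prems"(2) by simp
next
  case (Suc k)
  define g where "g y = (\<Sum>i\<le>k. c i * esym y i k)" for y
  define h where "h y = (\<Sum>i\<le>k. c (Suc i) * esym y i k)" for y
  have gh: "g y = 0 \<and> h y = 0" if y: "inj_on y {1..k}" for y
  proof -
    have eq: "g y + z * h y = 0" if z: "z \<notin> y ` {1..k}" for z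
    proof -
      define y' where "y' = y(Suc k := z)"
      have y'_z: "y' (Suc k) = z" by (simp add: y'_def)
      have "inj_on y' {1..k} \<longleftrightarrow> inj_on y {1..k}" by (rule inj_on_cong) (simp add: y'_def)
      with y have "inj_on y' {1..k}" by blast
      moreover have "y' (Suc k) \<notin> y' ` {1..k}" using z by (auto simp: y'_def)
      ultimately have "inj_on y' {1..Suc k}" by (intro inj_on_atLeastAtMost_Suc)
      then have "0 = (\<Sum>i\<le>Suc k. c i * esym y' i (Suc k))"
        by (rule Suc.prems(1)[symmetric])
      also have "\<dots> = (\<Sum>i\<le>Suc k. c i * esym y' i k)
          + z * (\<Sum>i\<le>Suc k. c i * (case i of 0 \<Rightarrow> 0 | Suc j \<Rightarrow> esym y' j k))"
        unfolding sum_distrib_left sum.distrib[symmetric]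
        by (intro sum.cong refl) (simp add: esym_Suc y'_z algebra_simps del: One_nat_def)
      also have "(\<Sum>i\<le>Suc k. c i * esym y' i k) = g y'"
        by (simp add: g_def esym_eq_0)
      also have "(\<Sum>i\<le>Suc k. c i * (case i of 0 \<Rightarrow> 0 | Suc j \<Rightarrow> esym y' j k)) = h y'"
        by (subst sum.atMost_Suc_shift) (simp add: h_def)
      also have "g y' = g y"
        unfolding g_def by (intro sum.cong refl arg_cong2[where f = "(*)"] esym_cong) (auto simp: y'_def)
      also have "h y' = h y"
        unfolding h_def by (intro sum.cong refl arg_cong2[where f = "(*)"] esym_cong) (auto simp: y'_def)
      finally show ?thesis by simp
    qed
    obtain z1 where z1: "z1 \<notin> y ` {1..k}"
      using ex_new_if_finite[of "y ` {1..k}"] by auto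
    obtain z2 where z2: "z2 \<notin> insert z1 (y ` {1..k})"
      using ex_new_if_finite[of "insert z1 (y ` {1..k})"] by auto
    have "(z1 - z2) * h y = 0"
    proof -
      have "(z1 - z2) * h y = (g y + z1 * h y) - (g y + z2 * h y)"
        by (simp add: algebra_simps)
      then show ?thesis using eq[OF z1] eq[of z2] z2 by simp
    qed
    then show ?thesis using z2 eq[OF z1] by auto
  qed
  show ?case
  proof (cases i)
    case 0
    then show ?thesis using Suc.IH[of c 0] gh by (simp add: g_def)
  next
    case (Suc j)
    then show ?thesis using Suc.IH[of "\<lambda>i. c (Suc i)" j] gh Suc.prems(2) by (simp add: h_def)
  qed
qed

text \<open>Degree in the single coordinate \<open>s\<close> of a function on integer points, all
  other coordinates being fixed. This form allows counting roots one coordinate at a time.\<close>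

definition degree_in_le :: "((nat \<Rightarrow> int) \<Rightarrow> int) \<Rightarrow> nat \<Rightarrow> nat \<Rightarrow> bool" where
  "degree_in_le F s d \<longleftrightarrow> (\<forall>x. \<exists>p. degree p \<le> d \<and> (\<forall>z. F (x(s := z)) = poly p z))"

lemma degree_in_le_const: "degree_in_le (\<lambda>x. a) s d"
  unfolding degree_in_le_def by (intro allI exI[of _ "[:a:]"]) simp

lemma degree_in_le_mono: "degree_in_le F s d \<Longrightarrow> d \<le> e \<Longrightarrow> degree_in_le F s e"
  unfolding degree_in_le_def using order.trans by blast

lemma degree_in_le_add:
  assumes "degree_in_le F s d" "degree_in_le G s d"
  shows "degree_in_le (\<lambda>x. F x + G x) s d"
  unfolding degree_in_le_def
proof
  fix x
  from assms obtain p q where "degree p \<le> d" "\<forall>z. F (x(s := z)) = poly p z"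
    "degree q \<le> d" "\<forall>z. G (x(s := z)) = poly q z"
    unfolding degree_in_le_def by meson
  then show "\<exists>p. degree p \<le> d \<and> (\<forall>z. F (x(s := z)) + G (x(s := z)) = poly p z)"
    by (intro exI[of _ "p + q"]) (auto intro: degree_add_le)
qed

lemma degree_in_le_mult:
  assumes "degree_in_le F s d" "degree_in_le G s e"
  shows "degree_in_le (\<lambda>x. F x * G x) s (d + e)"
  unfolding degree_in_le_def
proof
  fix x
  from assms obtain p q where "degree p \<le> d" "\<forall>z. F (x(s := z)) = poly p z"
    "degree q \<le> e" "\<forall>z. G (x(s := z)) = poly q z"
    unfolding degree_in_le_def by meson
  then show "\<exists>p. degree p \<le> d + e \<and> (\<forall>z. F (x(s := z)) * G (x(s := z)) = poly p z)"
    by (intro exI[of _ "p * q"]) (auto intro: order.trans[OF degree_mult_le])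
qed

lemma degree_in_le_sum:
  "(\<And>a. a \<in> A \<Longrightarrow> degree_in_le (F a) s d) \<Longrightarrow> degree_in_le (\<lambda>x. \<Sum>a\<in>A. F a x) s d"
  by (induction A rule: infinite_finite_induct) (auto intro: degree_in_le_add degree_in_le_const)

lemma degree_in_le_esym: "degree_in_le (\<lambda>x. esym x i k) s (if s \<le> k then 1 else 0)"
proof (induction k arbitrary: i)
  case 0
  show ?case by (simp add: degree_in_le_const)
next
  case (Suc k)
  show ?case
  proof (cases "s = Suc k")
    case True
    have "\<exists>p. degree p \<le> 1 \<and> (\<forall>z. esym (x(Suc k := z)) i (Suc k) = poly p z)" for x :: "nat \<Rightarrow> int"
    proof (intro exI conjI allI)
      let ?b = "case i of 0 \<Rightarrow> 0 | Suc j \<Rightarrow> esym x j k"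
      show "degree [:esym x i k, ?b:] \<le> 1" by simp
      have "esym (x(Suc k := z)) j k = esym x j k" for z j
        by (rule esym_cong) auto
      then show "esym (x(Suc k := z)) i (Suc k) = poly [:esym x i k, ?b:] z" for z
        by (simp add: esym_Suc split: nat.split)
    qed
    then show ?thesis by (simp add: True degree_in_le_def)
  next
    case False
    let ?d = "if s \<le> k then 1 else 0 :: nat"
    have x: "degree_in_le (\<lambda>x. x (Suc k)) s 0"
      unfolding degree_in_le_def
    proof
      show "\<exists>p. degree p \<le> 0 \<and> (\<forall>z. (x(s := z)) (Suc k) = poly p z)" for x :: "nat \<Rightarrow> int"
        using False by (intro exI[of _ "[:x (Suc k):]"]) simp
    qed
    have "degree_in_le (\<lambda>x. case i of 0 \<Rightarrow> 0 | Suc j \<Rightarrow> esym x j k) s ?d"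
      by (cases i) (use Suc.IH in \<open>simp_all add: degree_in_le_const\<close>)
    from degree_in_le_add[OF Suc.IH[of i] degree_in_le_mult[OF x this, simplified]]
    have "degree_in_le (\<lambda>x. esym x i (Suc k)) s ?d"
      by (simp add: esym_Suc)
    then show ?thesis using False by (auto elim: degree_in_le_mono)
  qed
qed

text \<open>The factors with s \<le> k \<le> m have degree at most one in x_s, the others are
  constant in it; for s > m the truncated difference is 0, as it should be.\<close>

lemma degree_in_le_prod_esym:
  "degree_in_le (\<lambda>x. \<Prod>k \<in> {1..m}. esym x (a k) k) s (Suc m - s)" if "1 \<le> s"
proof (induction m)
  case 0
  show ?case by (simp add: degree_in_le_const)
next
  case (Suc m)
  from degree_in_le_mult[OF Suc degree_in_le_esym[of "a (Suc m)" "Suc m" s]]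
  have "degree_in_le (\<lambda>x. \<Prod>k \<in> {1..Suc m}. esym x (a k) k) s (Suc m - s + (if s \<le> Suc m then 1 else 0))"
    by simp
  then show ?case by (rule degree_in_le_mono) auto
qed

text \<open>The coordinates are freed one at a time, last one first: once \<open>t\<close> distinct values are
  fixed, the remaining \<open>N - t\<close> elements of \<open>Y\<close> are zeros of a polynomial of smaller degree.\<close>

lemma vanishes_on_permutations_imp_zero:
  assumes deg: "\<And>s. 1 \<le> s \<Longrightarrow> s \<le> N \<Longrightarrow> degree_in_le F s (N - s)"
    and Y: "finite Y" "card Y = N"
    and vanish: "\<And>x. inj_on x {1..N} \<Longrightarrow> x ` {1..N} = Y \<Longrightarrow> F x = 0"
  shows "F x = 0"
proof -
  have "\<forall>x. inj_on x {1..t} \<longrightarrow> x ` {1..t} \<subseteq> Y \<longrightarrow> F x = 0" if "t \<le> N" for t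
    using that
  proof (induction t rule: inc_induct)
    case base
    have "x ` {1..N} = Y" if "inj_on x {1..N}" "x ` {1..N} \<subseteq> Y" for x
      using that Y card_subset_eq[of Y "x ` {1..N}"] by (simp add: card_image)
    with vanish show ?case by blast
  next
    case (step t)
    show ?case
    proof (intro allI impI)
      fix x assume x: "inj_on x {1..t}" "x ` {1..t} \<subseteq> Y"
      obtain p where p: "degree p \<le> N - Suc t" "\<And>z. F (x(Suc t := z)) = poly p z"
        using deg[of "Suc t"] step.hyps unfolding degree_in_le_def by fastforce
      have root: "poly p z = 0" if z: "z \<in> Y - x ` {1..t}" for z
      proof -
        let ?x = "x(Suc t := z)"
        have "inj_on ?x {1..t} \<longleftrightarrow> inj_on x {1..t}" by (rule inj_on_cong) simp
        with x(1) have "inj_on ?x {1..t}" by blast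
        moreover have "?x (Suc t) \<notin> ?x ` {1..t}" using z by auto
        ultimately have "inj_on ?x {1..Suc t}" by (intro inj_on_atLeastAtMost_Suc)
        moreover have "?x ` {1..Suc t} \<subseteq> Y" using z x(2) by (auto simp: image_subset_iff)
        ultimately have "F ?x = 0" using step.IH by blast
        then show ?thesis by (simp add: p(2))
      qed
      have "p = 0"
      proof (rule ccontr)
        assume "p \<noteq> 0"
        have "N - t = card (Y - x ` {1..t})"
          using x Y by (simp add: card_Diff_subset card_image)
        also have "\<dots> \<le> card {z. poly p z = 0}"
          using root \<open>p \<noteq> 0\<close> by (intro card_mono poly_roots_finite) auto
        also have "\<dots> \<le> degree p"
          using \<open>p \<noteq> 0\<close> by (rule card_poly_roots_bound)
        finally show False using p(1) step.hyps by simp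
      qed
      then show "F x = 0"
        using p(2)[of "x (Suc t)"] by simp
    qed
  qed
  from this[of 0] show ?thesis by simp
qed

text \<open>The index set is abstract so that the induction on \<open>m\<close> can pass to a fibre
  of the last exponent, where the remaining exponents still distinguish the indices.\<close>

lemma prod_esym_independent:
  fixes c :: "'i \<Rightarrow> int" and \<phi> :: "'i \<Rightarrow> nat \<Rightarrow> nat"
  assumes "finite S" "\<And>I k. I \<in> S \<Longrightarrow> \<phi> I k \<le> k"
    and "\<And>I J. I \<in> S \<Longrightarrow> J \<in> S \<Longrightarrow> (\<And>k. k \<in> {1..m} \<Longrightarrow> \<phi> I k = \<phi> J k) \<Longrightarrow> I = J"
    and "\<And>x. (\<Sum>I\<in>S. c I * (\<Prod>k \<in> {1..m}. esym x (\<phi> I k) k)) = 0"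
    and "I \<in> S"
  shows "c I = 0"
  using assms
proof (induction m arbitrary: S I)
  case 0
  from "0.prems"(3,5) have "S = {I}" by auto
  with "0.prems"(4) show ?case by simp
next
  case (Suc m)
  let ?N = "Suc m"
  define P where "P I x = (\<Prod>k \<in> {1..m}. esym x (\<phi> I k) k)" for I and x :: "nat \<Rightarrow> int"
  define f where "f i x = (\<Sum>I \<in> {I \<in> S. \<phi> I ?N = i}. c I * P I x)" for i x
  have group: "(\<Sum>i\<le>?N. f i x * e i) = (\<Sum>I\<in>S. c I * P I x * e (\<phi> I ?N))" for x and e :: "nat \<Rightarrow> int"
  proof -
    have "(\<Sum>i\<le>?N. f i x * e i) = (\<Sum>i\<le>?N. \<Sum>I \<in> {I \<in> S. \<phi> I ?N = i}. c I * P I x * e (\<phi> I ?N))"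
      unfolding f_def sum_distrib_right by (intro sum.cong refl) auto
    also have "\<dots> = (\<Sum>I\<in>S. c I * P I x * e (\<phi> I ?N))"
      using Suc.prems(1,2) by (intro sum.group) auto
    finally show ?thesis .
  qed
  have f0: "f i x = 0" if "i \<le> ?N" for i x
  proof (rule esym_independent[OF _ that])
    fix y :: "nat \<Rightarrow> int" assume y: "inj_on y {1..?N}"
    \<comment> \<open>Freezing the top factors at y keeps the degree of \<open>F\<close> in x_s down
      to \<open>?N - s\<close>; at permutations of y nothing changes, because these factors are
      symmetric.\<close>
    define F where "F x = (\<Sum>i\<le>?N. f i x * esym y i ?N)" for x
    have "F x = 0"
    proof (rule vanishes_on_permutations_imp_zero[where F = F and Y = "y ` {1..?N}" and N = ?N])
      show "degree_in_le F s (?N - s)" if "1 \<le> s" "s \<le> ?N" for s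
      proof -
        have "degree_in_le (\<lambda>x. c I * P I x * esym y (\<phi> I ?N) ?N) s (0 + (?N - s) + 0)" for I
          unfolding P_def using that
          by (intro degree_in_le_mult degree_in_le_const degree_in_le_prod_esym)
        then show ?thesis
          unfolding F_def group by (intro degree_in_le_sum) simp
      qed
      show "finite (y ` {1..?N})" by simp
      show "card (y ` {1..?N}) = ?N" using y by (simp add: card_image)
      fix x assume x: "inj_on x {1..?N}" "x ` {1..?N} = y ` {1..?N}"
      have "F x = (\<Sum>i\<le>?N. f i x * esym x i ?N)"
        unfolding F_def using esym_permute[OF x(1) y x(2)] by simp
      also have "\<dots> = 0"
        using Suc.prems(4)[of x] unfolding group by (simp add: P_def mult.assoc)
      finally show "F x = 0" .
    qed
    then show "(\<Sum>i\<le>?N. f i x * esym y i ?N) = 0"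
      by (simp add: F_def)
  qed
  show ?case
  proof (rule Suc.IH[of "{J \<in> S. \<phi> J ?N = \<phi> I ?N}"])
    fix J K assume JK: "J \<in> {J \<in> S. \<phi> J ?N = \<phi> I ?N}" "K \<in> {J \<in> S. \<phi> J ?N = \<phi> I ?N}"
      and eq: "\<And>k. k \<in> {1..m} \<Longrightarrow> \<phi> J k = \<phi> K k"
    have "\<phi> J k = \<phi> K k" if "k \<in> {1..?N}" for k
      using that eq[of k] JK by (cases "k = ?N") auto
    then show "J = K" using JK Suc.prems(3) by blast
  next
    show "(\<Sum>J \<in> {J \<in> S. \<phi> J ?N = \<phi> I ?N}. c J * (\<Prod>k \<in> {1..m}. esym x (\<phi> J k) k)) = 0" for x
      using f0[of "\<phi> I ?N" x] Suc.prems(2,5) by (simp add: f_def P_def)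
  qed (use Suc.prems in auto)
qed

section \<open>Uniqueness of the expansion in standard elementary monomials\<close>

lemma elem_sym_eq_esym: "elem_sym i k = esym (\<lambda>s. var (X s)) i k"
  by (simp add: elem_sym_def esym_eq_sum_subsets)

lemma peval_elem_sym: "peval \<sigma> (elem_sym i k) = esym (\<lambda>s. \<sigma> (X s)) i k"
proof -
  interpret comm_ring_hom "peval \<sigma>" by (rule peval_hom)
  show ?thesis
    by (simp add: elem_sym_def esym_eq_sum_subsets hom_sum hom_prod)
qed

lemma lin_std_elem_monomial_eq_0:
  assumes "Poly_Mapping.keys c \<subseteq> std_index" "lin std_elem_monomial c = 0"
  shows "c = 0"
proof (rule poly_mapping_eqI)
  fix I
  show "Poly_Mapping.lookup c I = Poly_Mapping.lookup 0 I"
  proof (cases "I \<in> Poly_Mapping.keys c")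
    case True
    have std: "Poly_Mapping.lookup J k \<le> k" if "J \<in> Poly_Mapping.keys c" for J k
      using subsetD[OF assms(1) that] by (simp add: std_index_def)
    \<comment> \<open>\<open>m\<close> bounds all positions that occur; the inserted 0 keeps
      \<open>Max\<close> defined if there are none. Position 0 never occurs, as its exponent is at
      most 0.\<close>
    define m where "m = Max (insert 0 (\<Union>I \<in> Poly_Mapping.keys c. Poly_Mapping.keys I))"
    have m: "Poly_Mapping.keys J \<subseteq> {1..m}" if "J \<in> Poly_Mapping.keys c" for J
    proof
      fix k assume k: "k \<in> Poly_Mapping.keys J"
      then have "k \<le> m"
        unfolding m_def using that by (intro Max_ge) auto
      moreover have "0 < Poly_Mapping.lookup J k"
        using k by (simp add: in_keys_iff)
      moreover have "Poly_Mapping.lookup J k \<le> k"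
        by (rule std[OF that])
      ultimately show "k \<in> {1..m}" by auto
    qed
    have "Poly_Mapping.lookup c I = 0"
    proof (rule prod_esym_independent[where c = "Poly_Mapping.lookup c" and I = I
          and S = "Poly_Mapping.keys c" and \<phi> = Poly_Mapping.lookup and m = m])
      show "I \<in> Poly_Mapping.keys c" by fact
      show "Poly_Mapping.lookup J k \<le> k" if "J \<in> Poly_Mapping.keys c" for J k
        using that by (rule std)
      show "J = K" if "J \<in> Poly_Mapping.keys c" "K \<in> Poly_Mapping.keys c"
        "\<And>k. k \<in> {1..m} \<Longrightarrow> Poly_Mapping.lookup J k = Poly_Mapping.lookup K k" for J K
      proof (rule poly_mapping_eqI)
        show "Poly_Mapping.lookup J k = Poly_Mapping.lookup K k" for k
        proof (cases "k \<in> {1..m}")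
          case False
          then have "k \<notin> Poly_Mapping.keys J" "k \<notin> Poly_Mapping.keys K"
            using m[OF that(1)] m[OF that(2)] by blast+
          then show ?thesis by (simp add: in_keys_iff)
        qed (rule that(3))
      qed
      fix x :: "nat \<Rightarrow> int"
      define \<sigma> where "\<sigma> v = (case v of X s \<Rightarrow> x s | Q _ _ \<Rightarrow> 0)" for v
      interpret comm_ring_hom "peval \<sigma>" by (rule peval_hom)
      have "peval \<sigma> (std_elem_monomial J) = (\<Prod>k \<in> {1..m}. esym x (Poly_Mapping.lookup J k) k)"
        if "J \<in> Poly_Mapping.keys c" for J
      proof -
        have "peval \<sigma> (std_elem_monomial J) = (\<Prod>k \<in> Poly_Mapping.keys J. esym x (Poly_Mapping.lookup J k) k)"
          by (simp add: std_elem_monomial_def hom_prod peval_elem_sym \<sigma>_def)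
        also have "\<dots> = (\<Prod>k \<in> {1..m}. esym x (Poly_Mapping.lookup J k) k)"
          using m[OF that] by (intro prod.mono_neutral_left) (auto simp: in_keys_iff)
        finally show ?thesis .
      qed
      moreover have "peval \<sigma> (lin std_elem_monomial c) = 0"
        by (simp add: assms(2))
      ultimately show "(\<Sum>J \<in> Poly_Mapping.keys c. Poly_Mapping.lookup c J *
          (\<Prod>k \<in> {1..m}. esym x (Poly_Mapping.lookup J k) k)) = 0"
        by (simp add: lin_def hom_sum hom_mult hom_of_int)
    qed simp
    then show ?thesis by simp
  qed (simp add: in_keys_iff)
qed

text \<open>Independence makes the expansion unique, so the definite description in
  \<open>std_coeffs\<close> yields \<open>c\<close>.\<close>

lemma quantization_lin:
  assumes "Poly_Mapping.keys c \<subseteq> std_index"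
  shows "quantization (lin std_elem_monomial c) = lin quantum_std_elem_monomial c"
proof -
  have "std_coeffs (lin std_elem_monomial c) = c"
    unfolding std_coeffs_def lin_def[symmetric]
  proof (rule the_equality)
    fix d assume d: "Poly_Mapping.keys d \<subseteq> std_index \<and> lin std_elem_monomial c = lin std_elem_monomial d"
    have "d - c = 0"
    proof (rule lin_std_elem_monomial_eq_0)
      show "Poly_Mapping.keys (d - c) \<subseteq> std_index"
        using keys_diff[of d c] d assms by blast
    qed (use d in \<open>simp add: lin_diff\<close>)
    then show "d = c" by simp
  qed (use assms in simp)
  then show ?thesis by (simp add: quantization_def lin_def)
qed

section \<open>Quantized complete symmetric polynomials\<close>

text \<open>Quantization as a relation that also records that only e^(k) with k < L occur.
  Quantization is not multiplicative in general, but it respects multiplication by e_i^(L) as long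
  as the other factor stays below L.\<close>

definition quantizable :: "nat \<Rightarrow> (qpoly \<times> qpoly) set" where
  "quantizable L = {(lin std_elem_monomial c, lin quantum_std_elem_monomial c) | c.
     \<forall>I \<in> Poly_Mapping.keys c. I \<in> std_index \<and> Poly_Mapping.keys I \<subseteq> {..<L}}"

lemma quantizableI:
  assumes "\<And>I. I \<in> Poly_Mapping.keys c \<Longrightarrow> I \<in> std_index \<and> Poly_Mapping.keys I \<subseteq> {..<L}"
    and "f = lin std_elem_monomial c" "F = lin quantum_std_elem_monomial c"
  shows "(f, F) \<in> quantizable L"
  using assms unfolding quantizable_def by blast

lemma quantizableE:
  assumes "(f, F) \<in> quantizable L"
  obtains c where "\<And>I. I \<in> Poly_Mapping.keys c \<Longrightarrow> I \<in> std_index \<and> Poly_Mapping.keys I \<subseteq> {..<L}"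
    and "f = lin std_elem_monomial c" "F = lin quantum_std_elem_monomial c"
  using assms unfolding quantizable_def by blast

lemma quantization_quantizable: "(f, F) \<in> quantizable L \<Longrightarrow> quantization f = F"
  by (erule quantizableE) (auto intro: quantization_lin)

lemma quantizable_0: "(0, 0) \<in> quantizable L"
  by (rule quantizableI[of 0]) auto

lemma quantizable_1: "(1, 1) \<in> quantizable L"
  by (rule quantizableI[of 1])
    (simp_all add: std_index_def std_elem_monomial_def quantum_std_elem_monomial_def)

lemma quantizable_add:
  assumes "(f, F) \<in> quantizable L" "(g, G) \<in> quantizable L"
  shows "(f + g, F + G) \<in> quantizable L"
proof -
  obtain c where c: "\<And>I. I \<in> Poly_Mapping.keys c \<Longrightarrow> I \<in> std_index \<and> Poly_Mapping.keys I \<subseteq> {..<L}"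
    "f = lin std_elem_monomial c" "F = lin quantum_std_elem_monomial c"
    using assms(1) by (erule quantizableE)
  obtain d where d: "\<And>I. I \<in> Poly_Mapping.keys d \<Longrightarrow> I \<in> std_index \<and> Poly_Mapping.keys I \<subseteq> {..<L}"
    "g = lin std_elem_monomial d" "G = lin quantum_std_elem_monomial d"
    using assms(2) by (erule quantizableE)
  show ?thesis
  proof (rule quantizableI[of "c + d"])
    show "I \<in> std_index \<and> Poly_Mapping.keys I \<subseteq> {..<L}" if "I \<in> Poly_Mapping.keys (c + d)" for I
      using that keys_add[of c d] c(1)[of I] d(1)[of I] by blast
  qed (simp_all add: c(2,3) d(2,3) lin_add)
qed

lemma quantizable_uminus:
  assumes "(f, F) \<in> quantizable L"
  shows "(- f, - F) \<in> quantizable L"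
proof -
  obtain c where c: "\<And>I. I \<in> Poly_Mapping.keys c \<Longrightarrow> I \<in> std_index \<and> Poly_Mapping.keys I \<subseteq> {..<L}"
    "f = lin std_elem_monomial c" "F = lin quantum_std_elem_monomial c"
    using assms by (erule quantizableE)
  then have "\<And>I. I \<in> Poly_Mapping.keys (- c) \<Longrightarrow> I \<in> std_index \<and> Poly_Mapping.keys I \<subseteq> {..<L}"
    unfolding keys_minus by blast
  then show ?thesis by (rule quantizableI[of "- c"]) (simp_all add: c(2,3) lin_uminus)
qed

lemma quantizable_alternating:
  "(f, F) \<in> quantizable L \<Longrightarrow> ((- 1) ^ i * f, (- 1) ^ i * F) \<in> quantizable L"
  by (induction i) (simp_all add: quantizable_uminus)

lemma quantizable_sum:
  "(\<And>a. a \<in> A \<Longrightarrow> (f a, F a) \<in> quantizable L) \<Longrightarrow> (sum f A, sum F A) \<in> quantizable L"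
proof (induction A rule: infinite_finite_induct)
  case (insert x A)
  have "(f x + sum f A, F x + sum F A) \<in> quantizable L"
    by (intro quantizable_add insert) auto
  with insert.hyps show ?case by simp
qed (simp_all add: quantizable_0)

lemma quantizable_mono:
  assumes "(f, F) \<in> quantizable L" "L \<le> L'"
  shows "(f, F) \<in> quantizable L'"
proof -
  obtain c where c: "\<And>I. I \<in> Poly_Mapping.keys c \<Longrightarrow> I \<in> std_index \<and> Poly_Mapping.keys I \<subseteq> {..<L}"
    "f = lin std_elem_monomial c" "F = lin quantum_std_elem_monomial c"
    using assms(1) by (erule quantizableE)
  have sub: "{..<L} \<subseteq> {..<L'}"
    using assms(2) by (simp only: lessThan_subset_iff)
  show ?thesis
  proof (rule quantizableI[of c])
    show "I \<in> std_index \<and> Poly_Mapping.keys I \<subseteq> {..<L'}" if "I \<in> Poly_Mapping.keys c" for I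
      using c(1)[OF that] order.trans[OF _ sub] by metis
  qed (rule c(2,3))+
qed

lemma E_0 [simp]: "E 0 j = 1"
  using coeff_path_wt_top[of 0 j] by (simp add: E_eq)

text \<open>No index uses position \<open>L\<close>, so placing \<open>i\<close> there multiplies
  each monomial and its quantum counterpart by the corresponding factor. The values i = 0 and i > L
  give no admissible nonzero entry; there both factors are 1 or both are 0.\<close>

lemma quantizable_elem_sym_mult:
  assumes "(f, F) \<in> quantizable L"
  shows "(elem_sym i L * f, E i L * F) \<in> quantizable (Suc L)"
proof -
  consider "i = 0" | "i > L" | "1 \<le> i" "i \<le> L" by linarith
  then show ?thesis
  proof cases
    case 1
    then show ?thesis using quantizable_mono[OF assms, of "Suc L"] by (simp add: elem_sym_eq_esym)
  next
    case 2
    then show ?thesis using quantizable_0 by (simp add: elem_sym_eq_esym esym_eq_0 E_def)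
  next
    case 3
    obtain c where c: "\<And>I. I \<in> Poly_Mapping.keys c \<Longrightarrow> I \<in> std_index \<and> Poly_Mapping.keys I \<subseteq> {..<L}"
      "f = lin std_elem_monomial c" "F = lin quantum_std_elem_monomial c"
      using assms by (erule quantizableE)
    let ?u = "Poly_Mapping.single L i"
    define d where "d = (\<Sum>I \<in> Poly_Mapping.keys c. Poly_Mapping.single (I + ?u) (Poly_Mapping.lookup c I))"
    have shift: "Poly_Mapping.keys (I + ?u) = insert L (Poly_Mapping.keys I)" "L \<notin> Poly_Mapping.keys I"
      "Poly_Mapping.lookup (I + ?u) L = i"
      "k \<noteq> L \<Longrightarrow> Poly_Mapping.lookup (I + ?u) k = Poly_Mapping.lookup I k"
      if "I \<in> Poly_Mapping.keys c" for I k
    proof -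
      show L: "L \<notin> Poly_Mapping.keys I" using c(1)[OF that] by auto
      show "Poly_Mapping.keys (I + ?u) = insert L (Poly_Mapping.keys I)"
        using 3 by (auto simp: in_keys_iff lookup_add lookup_single when_def split: if_splits)
      show "Poly_Mapping.lookup (I + ?u) L = i" using L by (simp add: lookup_add in_keys_iff)
      show "k \<noteq> L \<Longrightarrow> Poly_Mapping.lookup (I + ?u) k = Poly_Mapping.lookup I k"
        by (simp add: lookup_add lookup_single)
    qed
    have monomial: "(\<Prod>k \<in> Poly_Mapping.keys (I + ?u). g (Poly_Mapping.lookup (I + ?u) k) k)
        = g i L * (\<Prod>k \<in> Poly_Mapping.keys I. g (Poly_Mapping.lookup I k) k)"
      if "I \<in> Poly_Mapping.keys c" for I and g :: "nat \<Rightarrow> nat \<Rightarrow> qpoly"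
    proof -
      have "(\<Prod>k \<in> Poly_Mapping.keys I. g (Poly_Mapping.lookup (I + ?u) k) k)
          = (\<Prod>k \<in> Poly_Mapping.keys I. g (Poly_Mapping.lookup I k) k)"
      proof (rule prod.cong[OF refl])
        fix k assume "k \<in> Poly_Mapping.keys I"
        then have "k \<noteq> L" using shift(2)[OF that] by blast
        then show "g (Poly_Mapping.lookup (I + ?u) k) k = g (Poly_Mapping.lookup I k) k"
          by (simp add: shift(4)[OF that])
      qed
      then show ?thesis
        using shift(2)[OF that] by (simp add: shift(1,3)[OF that])
    qed
    have lin_d: "lin g d = (\<Sum>I \<in> Poly_Mapping.keys c. of_int (Poly_Mapping.lookup c I) * g (I + ?u))"
      for g :: "_ \<Rightarrow> qpoly"
      by (simp add: d_def lin_sum)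
    show ?thesis
    proof (rule quantizableI[of d])
      fix J assume "J \<in> Poly_Mapping.keys d"
      then have "J \<in> (\<Union>I \<in> Poly_Mapping.keys c. Poly_Mapping.keys (Poly_Mapping.single (I + ?u) (Poly_Mapping.lookup c I)))"
        unfolding d_def by (rule subsetD[OF keys_sum])
      then obtain I where I: "I \<in> Poly_Mapping.keys c" "J = I + ?u"
        by (auto split: if_splits)
      have "Poly_Mapping.lookup J k \<le> k" for k
        using c(1)[OF I(1)] shift(3)[OF I(1)] shift(4)[OF I(1), of k] 3 by (cases "k = L") (auto simp: I(2) std_index_def)
      moreover have "Poly_Mapping.keys J \<subseteq> {..<Suc L}"
        using c(1)[OF I(1)] shift(1)[OF I(1)] by (auto simp: I(2))
      ultimately show "J \<in> std_index \<and> Poly_Mapping.keys J \<subseteq> {..<Suc L}"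
        by (simp add: std_index_def)
    next
      show "elem_sym i L * f = lin std_elem_monomial d"
        unfolding c(2,3) lin_d unfolding lin_def sum_distrib_left
        by (intro sum.cong refl) (simp add: std_elem_monomial_def monomial[of _ elem_sym] mult.left_commute)
      show "E i L * F = lin quantum_std_elem_monomial d"
        unfolding c(2,3) lin_d unfolding lin_def sum_distrib_left
        by (intro sum.cong refl) (simp add: quantum_std_elem_monomial_def monomial[of _ E] mult.left_commute)
    qed
  qed
qed

section \<open>Recurrences for complete symmetric polynomials\<close>

lemma finite_multisets_size: "finite S \<Longrightarrow> finite {A. set_mset A \<subseteq> S \<and> size A = m}"
proof (induction m)
  case (Suc m)
  have "{A. set_mset A \<subseteq> S \<and> size A = Suc m}
      \<subseteq> (\<Union>x\<in>S. add_mset x ` {A. set_mset A \<subseteq> S \<and> size A = m})"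
  proof
    fix A assume A: "A \<in> {A. set_mset A \<subseteq> S \<and> size A = Suc m}"
    then obtain x B where "A = add_mset x B" by (auto dest: size_eq_Suc_imp_eq_union)
    with A show "A \<in> (\<Union>x\<in>S. add_mset x ` {A. set_mset A \<subseteq> S \<and> size A = m})" by auto
  qed
  then show ?case by (rule finite_subset) (use Suc in auto)
qed (simp add: conj_commute cong: conj_cong)

lemma complete_sym_0 [simp]: "complete_sym 0 k = 1"
proof -
  have "{A. set_mset A \<subseteq> {1..k} \<and> size A = 0} = {{#}}" by auto
  then show ?thesis by (simp add: complete_sym_def)
qed

lemma complete_sym_0_right: "complete_sym m 0 = (if m = 0 then 1 else 0)"
proof (cases "m = 0")
  case False
  then have "{A :: nat multiset. set_mset A \<subseteq> {1..0} \<and> size A = m} = {}" by auto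
  with False show ?thesis unfolding complete_sym_def by (simp only: sum.empty if_False)
qed simp

lemma complete_sym_Suc:
  "complete_sym (Suc m) (Suc k) = complete_sym (Suc m) k + var (X (Suc k)) * complete_sym m (Suc k)"
proof -
  let ?S = "\<lambda>m k. {A. set_mset A \<subseteq> {1..k} \<and> size A = m}"
  let ?w = "\<lambda>A. \<Prod>k \<in># A. var (X k)"
  have "?S (Suc m) (Suc k) = ?S (Suc m) k \<union> add_mset (Suc k) ` ?S m (Suc k)"
  proof (intro equalityI subsetI)
    fix A assume A: "A \<in> ?S (Suc m) (Suc k)"
    show "A \<in> ?S (Suc m) k \<union> add_mset (Suc k) ` ?S m (Suc k)"
    proof (cases "Suc k \<in># A")
      case True
      then obtain B where "A = add_mset (Suc k) B" by (meson multi_member_split)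
      with A show ?thesis by auto
    next
      case False
      have "set_mset A \<subseteq> {1..k}"
      proof
        fix a assume a: "a \<in> set_mset A"
        with A have "a \<in> {1..Suc k}" by blast
        moreover have "a \<noteq> Suc k" using a False by auto
        ultimately show "a \<in> {1..k}" by auto
      qed
      with A show ?thesis by auto
    qed
  qed auto
  moreover have "?S (Suc m) k \<inter> add_mset (Suc k) ` ?S m (Suc k) = {}" by auto
  ultimately have "complete_sym (Suc m) (Suc k)
      = (\<Sum>A \<in> ?S (Suc m) k. ?w A) + (\<Sum>A \<in> add_mset (Suc k) ` ?S m (Suc k). ?w A)"
    unfolding complete_sym_def
    by (simp only:) (intro sum.union_disjoint finite_imageI finite_multisets_size; simp)
  also have "(\<Sum>A \<in> add_mset (Suc k) ` ?S m (Suc k). ?w A) = (\<Sum>A \<in> ?S m (Suc k). ?w (add_mset (Suc k) A))"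
    by (subst sum.reindex) (auto simp: inj_on_def)
  finally show ?thesis
    by (simp add: complete_sym_def sum_distrib_left)
qed

text \<open>The generating functions are \<open>\<Prod>s\<le>l. (1 - x\<^sub>s t)\<close> and \<open>\<Prod>s\<le>k. 1 / (1 - x\<^sub>s t)\<close>; for \<open>k \<le> l\<close>
  their product is a polynomial of degree \<open>l - k\<close>.\<close>

lemma elem_complete_alternating_sum:
  assumes "d < m"
  shows "(\<Sum>i\<le>m. (- 1) ^ i * elem_sym i (k + d) * complete_sym (m - i) k) = 0"
proof -
  define e where "e l = Abs_fps (\<lambda>i. (- 1) ^ i * elem_sym i l)" for l
  define h where "h k = Abs_fps (\<lambda>m. complete_sym m k)" for k
  define b where "b k = 1 - fps_X * fps_const (var (X k))" for k
  have e: "e (Suc l) = e l * b (Suc l)" for l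
  proof (rule fps_ext)
    show "fps_nth (e (Suc l)) i = fps_nth (e l * b (Suc l)) i" for i
      by (cases i) (simp_all add: e_def b_def elem_sym_eq_esym esym_Suc algebra_simps)
  qed
  have h: "b (Suc k) * h (Suc k) = h k" for k
  proof (rule fps_ext)
    show "fps_nth (b (Suc k) * h (Suc k)) i = fps_nth (h k) i" for i
      by (cases i) (simp_all add: h_def b_def complete_sym_Suc algebra_simps)
  qed
  have eh: "e k * h k = 1" for k
  proof (induction k)
    case 0
    show ?case
      by (rule fps_ext) (simp add: e_def h_def elem_sym_eq_esym complete_sym_0_right fps_mult_nth
          if_distrib if_distribR sum.If_cases cong: if_cong)
  next
    case (Suc k)
    then show ?case by (simp add: e mult.assoc h)
  qed
  \<comment> \<open>Starting from the product 1 at d = 0, each further factor 1 - x t raises the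
    degree by at most one.\<close>
  have "\<forall>m > d. fps_nth (e (k + d) * h k) m = 0" for d
  proof (induction d)
    case 0
    show ?case by (simp add: eh)
  next
    case (Suc d)
    have eq: "e (k + Suc d) * h k = e (k + d) * h k - fps_X * (fps_const (var (X (Suc (k + d)))) * (e (k + d) * h k))"
      by (simp add: e b_def algebra_simps)
    show ?case
    proof (intro allI impI)
      fix m assume m: "Suc d < m"
      then obtain m' where "m = Suc m'" "d < m'" by (cases m) auto
      with Suc show "fps_nth (e (k + Suc d) * h k) m = 0"
        unfolding eq by simp
    qed
  qed
  with assms have "fps_nth (e (k + d) * h k) m = 0" by blast
  then show ?thesis
    by (simp add: fps_mult_nth e_def h_def atMost_atLeast0)
qed

lemma sum_atMost_split_0: "sum f {..m} = f 0 + sum f {1..m}" for f :: "nat \<Rightarrow> 'a::comm_monoid_add"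
  by (simp add: atMost_atLeast0 sum.atLeast_Suc_atMost)

text \<open>The vanishing sum with d = m - 1, the largest admissible value, solved for its term i =
  0. With this upper index every h on the right involves only e^(s) with s < k + m - 1, so the
  products expand into standard monomials directly.\<close>

lemma complete_sym_recurrence:
  assumes "1 \<le> m"
  shows "complete_sym m k
    = - (\<Sum>i=1..m. (- 1) ^ i * (elem_sym i (k + m - 1) * complete_sym (m - i) k))"
proof -
  have "0 = (\<Sum>i\<le>m. (- 1) ^ i * elem_sym i (k + (m - 1)) * complete_sym (m - i) k)"
    using assms by (intro elem_complete_alternating_sum[symmetric]) simp
  also have "k + (m - 1) = k + m - 1"
    using assms by simp
  finally have "0 = complete_sym m k
      + (\<Sum>i=1..m. (- 1) ^ i * (elem_sym i (k + m - 1) * complete_sym (m - i) k))"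
    unfolding sum_atMost_split_0 by (simp add: elem_sym_eq_esym mult.assoc)
  then show ?thesis
    by (rule eq_neg_iff_add_eq_0[THEN iffD2, OF sym])
qed

lemma H_recurrence:
  assumes "1 \<le> m"
  shows "H m k = - (\<Sum>i=1..m. (- 1) ^ i * (E i (k + m - 1) * H (m - i) k))"
proof -
  have rec: "(complete_sym m k, - (\<Sum>i=1..m. (- 1) ^ i * (E i (k + m - 1) * H (m - i) k))) \<in> quantizable (k + m)"
    if m: "1 \<le> m" and IH: "\<And>j. j < m \<Longrightarrow> (complete_sym j k, H j k) \<in> quantizable (k + j)" for m
    unfolding complete_sym_recurrence[OF m]
  proof (intro quantizable_uminus quantizable_sum quantizable_alternating)
    fix i assume i: "i \<in> {1..m}"
    have "(complete_sym (m - i) k, H (m - i) k) \<in> quantizable (k + m - 1)"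
      using i by (intro quantizable_mono[OF IH]) auto
    from quantizable_elem_sym_mult[OF this, of i] m
    show "(elem_sym i (k + m - 1) * complete_sym (m - i) k, E i (k + m - 1) * H (m - i) k) \<in> quantizable (k + m)"
      by simp
  qed
  have all: "(complete_sym m k, H m k) \<in> quantizable (k + m)" for m
  proof (induction m rule: less_induct)
    case (less m)
    show ?case
    proof (cases "m = 0")
      case True
      then show ?thesis using quantizable_1 by (simp add: H_def quantization_quantizable[OF quantizable_1])
    next
      case False
      then have "1 \<le> m" by simp
      note r = rec[OF this less.IH]
      have "H m k = - (\<Sum>i=1..m. (- 1) ^ i * (E i (k + m - 1) * H (m - i) k))"
        unfolding H_def[of m k] by (rule quantization_quantizable[OF r])
      with r show ?thesis by (simp only:)
    qed
  qed
  show ?thesis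
    unfolding H_def[of m k] by (rule quantization_quantizable[OF rec[OF assms all]])
qed

lemma H_0 [simp]: "H 0 k = 1"
  by (simp add: H_def quantization_quantizable[OF quantizable_1])

text \<open>Both families start with 1 and satisfy the same recurrence, \<open>H\<close> exactly and
  the path coefficients modulo the ideal, so their differences stay in the ideal.\<close>

lemma path_minus_H_in_E_ideal:
  assumes "k \<le> n" "m \<le> n - k"
  shows "coeff (path wt k n) (n - k - m) - H m k \<in> E_ideal n"
  using assms(2)
proof (induction m rule: less_induct)
  case (less m)
  define G where "G m = coeff (path wt k n) (n - k - m)" for m
  show ?case
  proof (cases "m = 0")
    case True
    then show ?thesis using coeff_path_wt_top[OF assms(1)] by (simp add: E_ideal_0)
  next
    case False
    then have m: "1 \<le> m" by simp
    let ?S = "\<Sum>i=1..m. (- 1) ^ i * (E i (k + m - 1) * (G (m - i) - H (m - i) k))"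
    have sum: "(\<Sum>i\<le>m. (- 1) ^ i * E i (k + m - 1) * G (m - i)) \<in> E_ideal n"
      unfolding G_def by (rule alternating_sum_in_E_ideal[OF assms(1) m less.prems])
    \<comment> \<open>By \<open>H_recurrence\<close> the \<open>H\<close> part of the sum over i
      \<ge> 1 is \<open>- H m k\<close>, which turns the alternating sum into a relation among
      differences.\<close>
    have eq: "(\<Sum>i\<le>m. (- 1) ^ i * E i (k + m - 1) * G (m - i)) = G m - H m k + ?S"
    proof -
      have "(\<Sum>i=1..m. (- 1) ^ i * E i (k + m - 1) * G (m - i))
          = (\<Sum>i=1..m. (- 1) ^ i * (E i (k + m - 1) * H (m - i) k)) + ?S"
        unfolding sum.distrib[symmetric] by (intro sum.cong refl) (simp add: right_diff_distrib mult.assoc)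
      also have "(\<Sum>i=1..m. (- 1) ^ i * (E i (k + m - 1) * H (m - i) k)) = - H m k"
        using H_recurrence[OF m] by (simp only: minus_minus)
      finally show ?thesis
        unfolding sum_atMost_split_0 by simp
    qed
    have "?S \<in> E_ideal n"
    proof (rule E_ideal_sum)
      fix i assume i: "i \<in> {1..m}"
      then have "G (m - i) - H (m - i) k \<in> E_ideal n"
        unfolding G_def using less by (intro less.IH) auto
      moreover have "E i (k + m - 1) \<in> carrier (R n)"
        using less.prems m assms(1) by (intro E_in_R) auto
      ultimately show "(- 1) ^ i * (E i (k + m - 1) * (G (m - i) - H (m - i) k)) \<in> E_ideal n"
        by (intro E_ideal_mult R_minus_one_power)
    qed
    from E_ideal_diff[OF sum this] have "G m - H m k \<in> E_ideal n"
      unfolding eq add_diff_cancel_right' .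
    then show ?thesis by (simp add: G_def)
  qed
qed

section \<open>The involution on the quotient\<close>

lemma R_of_int: "of_int a \<in> carrier (R n)"
proof -
  have "of_nat m \<in> carrier (R n)" for m by (induction m) (auto intro: R_add)
  then show ?thesis by (cases a rule: int_cases2) (auto intro: R_uminus)
qed

lemma R_prod: "(\<And>a. a \<in> A \<Longrightarrow> f a \<in> carrier (R n)) \<Longrightarrow> prod f A \<in> carrier (R n)"
  by (induction A rule: infinite_finite_induct) (auto intro: R_mult)

lemma omega_var_in_R:
  assumes "v \<in> vars_R n"
  shows "omega_var n v \<in> carrier (R n)"
proof (cases v)
  case (X i)
  then have "X (n + 1 - i) \<in> vars_R n" using assms by (auto simp: vars_R_def)
  then show ?thesis unfolding X omega_var.simps by (intro R_uminus R_var)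
next
  case (Q i j)
  then have "1 \<le> i" "i < j" "j \<le> n" using assms by (auto simp: vars_R_def)
  then have "1 \<le> n + 1 - j" "n + 1 - j < n + 1 - i" "n + 1 - i \<le> n" by linarith+
  then have "Q (n + 1 - j) (n + 1 - i) \<in> vars_R n" unfolding vars_R_def by blast
  then show ?thesis unfolding Q omega_var.simps by (intro R_mult R_minus_one_power R_var)
qed

lemma omega_in_R:
  assumes "p \<in> carrier (R n)"
  shows "omega n p \<in> carrier (R n)"
  unfolding omega_def subst_def
proof (intro R_sum R_mult R_of_int R_prod R_power)
  fix m v assume "m \<in> Poly_Mapping.keys p" "v \<in> Poly_Mapping.keys m"
  then have "v \<in> vars_R n" using assms unfolding carrier_R by blast
  then show "omega_var n v \<in> carrier (R n)" by (rule omega_var_in_R)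
qed

text \<open>The elements of R_n mapped into the ideal form an ideal themselves. It contains the
  generators, since \<omega>(E_i^(n)) is a coefficient of P(0,n) below the leading term.\<close>

lemma omega_E_ideal:
  assumes "p \<in> E_ideal n"
  shows "omega n p \<in> E_ideal n"
proof -
  interpret \<omega>: comm_ring_hom "omega n" by (rule omega_hom)
  let ?J = "{p \<in> carrier (R n). omega n p \<in> E_ideal n}"
  have ring: "ring (R n)" using cring_R by (rule cring.axioms(1))
  have "ideal ?J (R n)"
  proof (rule idealI[OF ring])
    show "subgroup ?J (add_monoid (R n))"
    proof (rule group.subgroupI[OF abelian_group.a_group[OF ring.is_abelian_group[OF ring]]])
      fix p assume p: "p \<in> ?J"
      have "inv\<^bsub>add_monoid (R n)\<^esub> p = \<ominus>\<^bsub>R n\<^esub> p" by (simp add: a_inv_def)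
      also have "\<dots> = - p"
        using p R_uminus[of p n]
        by (intro abelian_group.minus_equality[OF ring.is_abelian_group[OF ring]]) auto
      finally show "inv\<^bsub>add_monoid (R n)\<^esub> p \<in> ?J"
        using p by (auto intro: R_uminus E_ideal_uminus simp: \<omega>.hom_uminus)
    next
      show "?J \<noteq> {}" using E_ideal_0 R_0 by fastforce
    qed (auto intro: R_add E_ideal_add simp: \<omega>.hom_add)
  next
    fix a x assume a: "a \<in> ?J" and x: "x \<in> carrier (R n)"
    then show "x \<otimes>\<^bsub>R n\<^esub> a \<in> ?J"
      by (auto intro: R_mult E_ideal_mult omega_in_R simp: \<omega>.hom_mult)
    then show "a \<otimes>\<^bsub>R n\<^esub> x \<in> ?J" by (simp add: mult.commute)
  qed
  moreover have "{E i n | i. 1 \<le> i \<and> i \<le> n} \<subseteq> ?J"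
  proof safe
    fix i assume i: "1 \<le> i" "i \<le> n"
    then show "E i n \<in> carrier (R n)" by (intro E_in_R) simp
    show "omega n (E i n) \<in> E_ideal n"
      using i by (simp add: omega_E coeff_path_in_E_ideal)
  qed
  ultimately have "E_ideal n \<subseteq> ?J"
    unfolding E_ideal_def[of n] by (intro ring.genideal_minimal[OF ring])
  then show ?thesis using assms by blast
qed

section \<open>Cosets and the induced map\<close>

lemma to_Q_eq: "to_Q n f = {p + f | p. p \<in> E_ideal n}"
  by (auto simp: to_Q_def a_r_coset_def r_coset_def)

lemma to_Q_eqI:
  assumes "f - g \<in> E_ideal n"
  shows "to_Q n f = to_Q n g"
proof -
  have "to_Q n f \<subseteq> to_Q n g" if "f - g \<in> E_ideal n" for f g
  proof
    fix x assume "x \<in> to_Q n f"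
    then obtain p where "p \<in> E_ideal n" "x = (p + (f - g)) + g"
      by (auto simp: to_Q_eq)
    then show "x \<in> to_Q n g"
      unfolding to_Q_eq using E_ideal_add[OF _ that] by blast
  qed
  from this[OF assms] this[of g f] show ?thesis
    using E_ideal_uminus[OF assms] by simp
qed

text \<open>\<omega> preserves the ideal, so all representatives of a coset have images in one
  coset, and \<open>the_elem\<close> is applied to a singleton.\<close>

lemma omega_Q_to_Q:
  assumes "f \<in> carrier (R n)"
  shows "omega_Q n (to_Q n f) = to_Q n (omega n f)"
proof -
  interpret \<omega>: comm_ring_hom "omega n" by (rule omega_hom)
  have "to_Q n f \<in> carrier (Q_ring n)"
    using assms by (auto simp: Q_ring_def FactRing_def A_RCOSETS_def' to_Q_def)
  moreover have "(\<lambda>g. to_Q n (omega n g)) ` to_Q n f = {to_Q n (omega n f)}"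
  proof -
    have "to_Q n (omega n g) = to_Q n (omega n f)" if "g \<in> to_Q n f" for g
      using that by (intro to_Q_eqI) (auto simp: to_Q_eq \<omega>.hom_add omega_E_ideal)
    moreover have "f \<in> to_Q n f"
      using E_ideal_0 by (force simp: to_Q_eq)
    ultimately show ?thesis by blast
  qed
  ultimately show ?thesis by (simp add: omega_Q_def)
qed

theorem proposition4p2:
  fixes n i j :: nat
  assumes "n > 0" and "1 \<le> i" and "i \<le> j" and "j \<le> n"
  shows "omega_Q n (to_Q n (E i j)) = to_Q n (H i (n - j))"
proof -
  have "omega_Q n (to_Q n (E i j)) = to_Q n (omega n (E i j))"
    using assms by (intro omega_Q_to_Q E_in_R)
  \<comment> \<open>For k = n - j and m = i the index n - k - m is j - i, the coefficient given by
    \<open>omega_E\<close>.\<close>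
  also have "\<dots> = to_Q n (H i (n - j))"
    using path_minus_H_in_E_ideal[of "n - j" n i] assms by (intro to_Q_eqI) (simp add: omega_E)
  finally show ?thesis .
qed

end
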